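(* Let $(x_n)_{n\ge 1}$ be a non-increasing sequence of positive numbers with $x_n\to 0$, $x_n2^{-2n}<1$ for all $n$, and $\sum_{n\ge 1}x_n=+\infty$, and let $B$ be the Blaschke product whose zeros are $\lambda_n=(1-x_n2^{-2n})e^{i2^{-n}}$, $n\ge 1$. Set $\sigma_N:=\sum_{n=1}^N x_n$, let $\varphi_0:[1,\infty)\to(0,\infty)$ be the continuous piecewise affine function (affine on each interval $[N,N+1]$, $N\ge 1$) with $\varphi_0(N)=\sigma_N$ for every integer $N\ge 1$, and define $\varphi(y):=\varphi_0\left(\log_2\frac{1}{1-y}\right)$ for $y\in[1/2,1)$. Then for every $\varepsilon>0$ there exists $f\in(BH^2)^\perp$ such that for every $\alpha\in(1,\infty)$, $$|f(z)|\gtrsim\sqrt{\frac{\varphi(|z|)}{\log^{1+\varepsilon}\varphi(|z|)}},\qquad z\in\Gamma_{\alpha,1},\ |z|\to 1^-,$$ i.e. there are $c>0$ and $r_0\in[1/2,1)$ (depending on $\alpha$) such that $\varphi(|z|)>1$ and $|f(z)|\ge c\,\sqrt{\varphi(|z|)/(\log\varphi(|z|))^{1+\varepsilon}}$ for all $z\in\Gamma_{\alpha,1}$ with $|z|\ge r_0$.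
   Context: $\mathbb D=\{|z|<1\}$; $H^2$ is the Hardy space of $\mathbb D$, and $(BH^2)^\perp=H^2\ominus BH^2$ is the orthogonal complement of $BH^2$ in $H^2$. For $\alpha\in(1,\infty)$ the Stolz domain at $1$ is $\Gamma_{\alpha,1}=\{z\in\mathbb D:\frac{|z-1|}{1-|z|}<\alpha\}$. *)

theory Defs
  imports "HOL-Complex_Analysis.Complex_Analysis"
begin

text \<open>
  Functions on the open unit disc are total functions of type \<open>complex \<Rightarrow> complex\<close>;
  their values outside \<open>ball 0 1\<close> are irrelevant to everything below.
\<close>

definition hardy_H2 :: "(complex \<Rightarrow> complex) set" where
  "hardy_H2 = {f. f holomorphic_on ball 0 1 \<and>
     bdd_above ((\<lambda>r::real. integral {0..2*pi} (\<lambda>t. (cmod (f (of_real r * cis t)))\<^sup>2) / (2*pi)) ` {0..<1})}"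

text \<open>
  For \<open>f\<close> and \<open>g\<close> in \<open>hardy_H2\<close> the limit below exists, and it is the scalar product of the
  boundary functions in \<open>L\<^sup>2\<close> of the unit circle with normalized Lebesgue measure.
\<close>

definition hardy_inner :: "(complex \<Rightarrow> complex) \<Rightarrow> (complex \<Rightarrow> complex) \<Rightarrow> complex" where
  "hardy_inner f g = Lim (at_left (1::real))
     (\<lambda>r. integral {0..2*pi} (\<lambda>t. f (of_real r * cis t) * cnj (g (of_real r * cis t))) / (2*pi))"

definition hardy_orth_compl :: "(complex \<Rightarrow> complex) set \<Rightarrow> (complex \<Rightarrow> complex) set" where
  "hardy_orth_compl M = {f \<in> hardy_H2. \<forall>h\<in>M. hardy_inner f h = 0}"

definition mult_H2 :: "(complex \<Rightarrow> complex) \<Rightarrow> (complex \<Rightarrow> complex) set" where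
  "mult_H2 B = {(\<lambda>z. B z * g z) |g. g \<in> hardy_H2}"

definition blaschke_factor :: "complex \<Rightarrow> complex \<Rightarrow> complex" where
  "blaschke_factor a z =
     (if a = 0 then z else (of_real (cmod a) / a) * ((a - z) / (1 - cnj a * z)))"

text \<open>
  \<open>prodinf\<close> disregards finitely many vanishing factors when testing convergence, so for a
  sequence satisfying the Blaschke condition the value at a zero \<open>a n\<close> is indeed \<open>0\<close>.
\<close>

definition blaschke_product :: "(nat \<Rightarrow> complex) \<Rightarrow> complex \<Rightarrow> complex" where
  "blaschke_product a z = prodinf (\<lambda>n. blaschke_factor (a n) z)"

definition stolz_domain :: "real \<Rightarrow> complex \<Rightarrow> complex set" where
  "stolz_domain \<alpha> \<zeta> = {z \<in> ball 0 1. cmod (z - \<zeta>) / (1 - cmod z) < \<alpha>}"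

end

theory Submission
  imports Defs "HOL-Real_Asymp.Real_Asymp"
begin

text \<open>
  Write \<open>k\<^sub>n(z) = 1 / (1 - cnj \<lambda>\<^sub>n z)\<close>, \<open>s\<^sub>n = e + \<sigma>\<^sub>n\<close>, \<open>w\<^sub>n = (s\<^sub>n ln(s\<^sub>n) powr (1 + \<epsilon>)) powr (-1/2)\<close>, and take
  \<open>f = \<Sum> x\<^sub>n w\<^sub>n 2\<^sup>-\<^sup>n k\<^sub>n\<close>. Each \<open>k\<^sub>n\<close> is orthogonal to \<open>B H\<^sup>2\<close> by the reproducing property. In the Gram matrix
  of the summands the diagonal entries are at most \<open>x\<^sub>n w\<^sub>n\<^sup>2\<close>, which are summable by comparison with
  \<open>\<integral> ds / (s ln(s) powr (1 + \<epsilon>))\<close>, and the off-diagonal entries are \<open>O(2\<^sup>-\<^sup>m)\<close> with \<open>m\<close> the larger index,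
  because the arguments \<open>2\<^sup>-\<^sup>n\<close> are dyadically separated; hence \<open>f \<in> H\<^sup>2\<close>. For \<open>z\<close> in a Stolz domain with
  \<open>1 - |z|\<close> of order \<open>2\<^sup>-\<^sup>N\<close>, the kernels with \<open>n \<le> N - C\<close> satisfy \<open>- Im k\<^sub>n(z) \<ge> c 2\<^sup>n\<close> and the remaining terms
  add up to \<open>O(1)\<close>, so that \<open>|f(z)| \<ge> c (\<Sum>n\<le>N-C. x\<^sub>n w\<^sub>n) - O(1) \<ge> c \<sigma>\<^bsub>N-C\<^esub> w\<^bsub>N-C\<^esub> - O(1)\<close>.
\<close>

section \<open>Series of Szego kernels\<close>

definition szego_kernel :: "complex \<Rightarrow> complex \<Rightarrow> complex" where
  "szego_kernel a z = 1 / (1 - cnj a * z)"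

lemma norm_one_minus_cnj_mult:
  assumes "cmod a < 1" "cmod z < 1"
  shows "1 - cmod z \<le> cmod (1 - cnj a * z)" "1 - cnj a * z \<noteq> 0"
proof -
  have "cmod (cnj a * z) \<le> 1 * cmod z"
    unfolding norm_mult by (rule mult_right_mono) (use assms in auto)
  then show *: "1 - cmod z \<le> cmod (1 - cnj a * z)"
    using norm_triangle_ineq2[of 1 "cnj a * z"] by simp
  show "1 - cnj a * z \<noteq> 0"
    using * assms(2) by auto
qed

lemma norm_szego_kernel_le:
  assumes "cmod a < 1" "cmod z < 1"
  shows "cmod (szego_kernel a z) \<le> 1 / (1 - cmod z)"
  using norm_one_minus_cnj_mult[OF assms] assms(2)
  by (auto simp: szego_kernel_def norm_divide intro!: divide_left_mono mult_pos_pos)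

lemma holomorphic_szego_kernel:
  assumes "cmod a < 1"
  shows "szego_kernel a holomorphic_on ball 0 1"
  unfolding szego_kernel_def[abs_def]
  by (intro holomorphic_intros) (use norm_one_minus_cnj_mult[OF assms] in auto)

section \<open>Integrals over circles: reproducing formula, mean squares, pairings\<close>

lemma continuous_on_circle:
  fixes h :: "complex \<Rightarrow> complex"
  assumes "h holomorphic_on ball 0 1" "0 \<le> r" "r < 1"
  shows "continuous_on S (\<lambda>t. h (of_real r * cis t))"
proof -
  have "continuous_on (ball 0 1) h"
    using assms(1) by (rule holomorphic_on_imp_continuous_on)
  then show ?thesis
    by (rule continuous_on_compose2) (use assms in \<open>auto intro!: continuous_intros simp: norm_mult\<close>)
qed

text \<open>On the circle of radius r the conjugate of u is r^2/u, so the conjugated kernel equals u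
  / (u - r^2 a) and the integral is Cauchy's formula at r^2 a. Staying on inner circles avoids
  boundary values; the price is that \<open>a\<close> is contracted by r^2.\<close>

lemma integral_mult_cnj_szego_kernel:
  fixes h :: "complex \<Rightarrow> complex"
  assumes h: "h holomorphic_on ball 0 1" and r: "0 \<le> r" "r < 1" and a: "cmod a < 1"
  shows "integral {0..2*pi} (\<lambda>t. h (of_real r * cis t) * cnj (szego_kernel a (of_real r * cis t)))
         = 2 * pi * h (of_real (r\<^sup>2) * a)"
proof (cases "r = 0")
  case True
  then show ?thesis by (simp add: szego_kernel_def scaleR_conv_of_real)
next
  case False
  with r have r: "0 < r" "r < 1" by auto
  define w where "w = of_real (r\<^sup>2) * a"
  have w: "cmod (w - 0) < r"
  proof -
    have "cmod w = r * (r * cmod a)" by (simp add: w_def norm_mult power2_eq_square norm_power)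
    also have "r * cmod a < 1"
      using r a by (smt (verit, best) mult_le_one mult_less_cancel_right2 norm_ge_zero mult_le_cancel_left2)
    then have "r * (r * cmod a) < r * 1" using r by (intro mult_strict_left_mono) auto
    finally show ?thesis by simp
  qed
  have "h holomorphic_on cball 0 r"
    by (rule holomorphic_on_subset[OF h]) (use r in auto)
  from Cauchy_integral_circlepath_simple[OF this w]
  have "((\<lambda>t. h (of_real r * cis t) / (of_real r * cis t - w) * r * \<i> * cis t) has_integral
          (2 * of_real pi * \<i> * h w)) {0..2*pi}"
    unfolding circlepath_def by (subst (asm) has_contour_integral_part_circlepath_iff) auto
  from has_integral_mult_right[OF this, of "-\<i>"]
  have *: "((\<lambda>t. - \<i> * (h (of_real r * cis t) / (of_real r * cis t - w) * r * \<i> * cis t)) has_integral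
          (2 * pi * h w)) {0..2*pi}"
    by (simp add: algebra_simps)
  have "- \<i> * (h (of_real r * cis t) / (of_real r * cis t - w) * r * \<i> * cis t) =
        h (of_real r * cis t) * cnj (szego_kernel a (of_real r * cis t))" for t
  proof -
    have nz: "of_real r * cis t - w \<noteq> 0"
    proof
      assume "of_real r * cis t - w = 0"
      then have "cmod (of_real r * cis t) = cmod w" by simp
      with w r show False by (simp add: norm_mult)
    qed
    have "of_real r * cis t - w = of_real r * cis t * (1 - a * cnj (of_real r * cis t))"
    proof -
      have "cis t * cnj (cis t) = 1" by (simp add: cis_cnj cis_mult)
      then show ?thesis unfolding w_def power2_eq_square complex_cnj_mult of_real_mult complex_cnj_complex_of_real
        by algebra
    qed
    then have "of_real r * cis t / (of_real r * cis t - w) = 1 / (1 - a * cnj (of_real r * cis t))"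
      using r by simp
    moreover have "- \<i> * (h (of_real r * cis t) / (of_real r * cis t - w) * r * \<i> * cis t) =
        - (\<i> * \<i>) * (h (of_real r * cis t) * (of_real r * cis t / (of_real r * cis t - w)))"
      by (simp add: mult_ac)
    ultimately show ?thesis by (simp add: szego_kernel_def)
  qed
  with * show ?thesis by (simp add: integral_unique w_def)
qed

text \<open>The square expands into a double sum of pairings of kernels. The reproducing formula,
  applied with a kernel in the role of \<open>h\<close>, evaluates each of them, and the triangle
  inequality removes all phases.\<close>

lemma mean_square_szego_sum_le:
  assumes a: "\<And>n. n \<in> A \<Longrightarrow> cmod (a n) < 1" and A: "finite A" and r: "0 \<le> r" "r < 1"
  shows "integral {0..2*pi} (\<lambda>t. (cmod (\<Sum>n\<in>A. b n * szego_kernel (a n) (of_real r * cis t)))\<^sup>2) / (2*pi)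
    \<le> (\<Sum>n\<in>A. \<Sum>m\<in>A. cmod (b n) * cmod (b m) / cmod (1 - of_real (r\<^sup>2) * (cnj (a n) * a m)))"
    (is "?I / _ \<le> ?G")
proof -
  define k where "k n t = szego_kernel (a n) (of_real r * cis t)" for n t
  have cont: "continuous_on {0..2*pi} (k n)" if "n \<in> A" for n
    unfolding k_def by (rule continuous_on_circle[OF holomorphic_szego_kernel]) (use a that r in auto)
  have sq: "of_real ((cmod (\<Sum>n\<in>A. b n * k n t))\<^sup>2) =
      (\<Sum>n\<in>A. \<Sum>m\<in>A. b n * cnj (b m) * (k n t * cnj (k m t)))" for t
    by (simp only: complex_norm_square cnj_sum sum_product complex_cnj_mult mult_ac)
  have int: "(\<lambda>t. k n t * cnj (k m t)) integrable_on {0..2*pi}" if "n \<in> A" "m \<in> A" for n m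
    by (intro integrable_continuous_interval continuous_intros cont that)
  have kk: "integral {0..2*pi} (\<lambda>t. k n t * cnj (k m t)) = 2 * pi * szego_kernel (a n) (of_real (r\<^sup>2) * a m)"
    if "n \<in> A" "m \<in> A" for n m
    unfolding k_def
    by (rule integral_mult_cnj_szego_kernel[OF holomorphic_szego_kernel]) (use a that r in auto)
  have "(\<lambda>t. (cmod (\<Sum>n\<in>A. b n * k n t))\<^sup>2) integrable_on {0..2*pi}"
    by (intro integrable_continuous_interval continuous_intros cont)
  then have "of_real ?I = integral {0..2*pi} (\<lambda>t. complex_of_real ((cmod (\<Sum>n\<in>A. b n * k n t))\<^sup>2))"
    unfolding k_def by (rule integral_linear[OF _ bounded_linear_of_real, unfolded o_def, symmetric])
  also have "\<dots> = (\<Sum>n\<in>A. \<Sum>m\<in>A. b n * cnj (b m) * (2 * pi * szego_kernel (a n) (of_real (r\<^sup>2) * a m)))"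
  proof -
    have "integral {0..2*pi} (\<lambda>t. \<Sum>n\<in>A. \<Sum>m\<in>A. b n * cnj (b m) * (k n t * cnj (k m t)))
      = (\<Sum>n\<in>A. integral {0..2*pi} (\<lambda>t. \<Sum>m\<in>A. b n * cnj (b m) * (k n t * cnj (k m t))))"
      by (intro integral_sum A integrable_sum integrable_on_mult_right int)
    also have "\<dots> = (\<Sum>n\<in>A. \<Sum>m\<in>A. integral {0..2*pi} (\<lambda>t. b n * cnj (b m) * (k n t * cnj (k m t))))"
      by (intro sum.cong refl integral_sum A integrable_on_mult_right int)
    finally show ?thesis unfolding sq by (simp add: kk)
  qed
  also have "\<dots> = of_real (2*pi) *
      (\<Sum>n\<in>A. \<Sum>m\<in>A. b n * cnj (b m) * szego_kernel (a n) (of_real (r\<^sup>2) * a m))"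
    unfolding sum_distrib_left by (intro sum.cong refl) simp
  finally have "of_real (?I / (2*pi)) =
      (\<Sum>n\<in>A. \<Sum>m\<in>A. b n * cnj (b m) * szego_kernel (a n) (of_real (r\<^sup>2) * a m))"
    by (simp only: of_real_divide nonzero_mult_div_cancel_left of_real_eq_0_iff pi_neq_zero mult_eq_0_iff) simp
  from arg_cong[OF this, of Re] have "?I / (2*pi) \<le> cmod (\<Sum>n\<in>A. \<Sum>m\<in>A. b n * cnj (b m) * szego_kernel (a n) (of_real (r\<^sup>2) * a m))"
    unfolding Re_complex_of_real by (simp only: complex_Re_le_cmod)
  also have "\<dots> \<le> ?G"
    proof (intro sum_norm_le)
    fix n m
    show "cmod (b n * cnj (b m) * szego_kernel (a n) (of_real (r\<^sup>2) * a m))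
        \<le> cmod (b n) * cmod (b m) / cmod (1 - of_real (r\<^sup>2) * (cnj (a n) * a m))"
      unfolding szego_kernel_def mult.left_commute[of "cnj (a n)"] norm_mult norm_divide by simp
  qed
  finally show ?thesis .
qed

text \<open>A weighted arithmetic-geometric mean inequality under the integral takes the place of
  Cauchy-Schwarz. The free weight \<open>d\<close> is chosen later to make a small mean square of
  \<open>F\<close> outweigh a merely bounded one of \<open>H\<close>.\<close>

lemma norm_integral_mult_cnj_le:
  fixes F H :: "real \<Rightarrow> complex"
  assumes F: "continuous_on {x..y} F" and H: "continuous_on {x..y} H" and d: "d > 0"
  shows "cmod (integral {x..y} (\<lambda>t. F t * cnj (H t)))
    \<le> (integral {x..y} (\<lambda>t. (cmod (F t))\<^sup>2) / d + d * integral {x..y} (\<lambda>t. (cmod (H t))\<^sup>2)) / 2"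
proof -
  have FF: "(\<lambda>t. (cmod (F t))\<^sup>2) integrable_on {x..y}" and HH: "(\<lambda>t. (cmod (H t))\<^sup>2) integrable_on {x..y}"
    by (intro integrable_continuous_interval continuous_intros F H)+
  have am_gm: "u * v \<le> (u\<^sup>2 / d + d * v\<^sup>2) / 2" for u v :: real
  proof -
    have "0 \<le> (u - d * v)\<^sup>2 / d" using d by simp
    also have "\<dots> = u\<^sup>2 / d + d * v\<^sup>2 - 2 * (u * v)"
      using d by (simp add: power2_eq_square field_simps)
    finally show ?thesis by simp
  qed
  have "cmod (integral {x..y} (\<lambda>t. F t * cnj (H t)))
      \<le> integral {x..y} (\<lambda>t. ((cmod (F t))\<^sup>2 / d + d * (cmod (H t))\<^sup>2) / 2)"
  proof (rule integral_norm_bound_integral)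
    show "(\<lambda>t. F t * cnj (H t)) integrable_on {x..y}"
      by (intro integrable_continuous_interval continuous_intros F H)
    show "(\<lambda>t. ((cmod (F t))\<^sup>2 / d + d * (cmod (H t))\<^sup>2) / 2) integrable_on {x..y}"
      by (intro integrable_on_divide integrable_add integrable_on_mult_right FF HH)
  qed (use am_gm in \<open>simp add: norm_mult\<close>)
  also have "\<dots> = (integral {x..y} (\<lambda>t. (cmod (F t))\<^sup>2) / d + d * integral {x..y} (\<lambda>t. (cmod (H t))\<^sup>2)) / 2"
    using integral_add[OF integrable_on_divide[OF FF, of d] integrable_on_mult_right[OF HH, of d]] by simp
  finally show ?thesis .
qed

section \<open>Infinite kernel series: convergence, holomorphy, orthogonality\<close>

lemma szego_series_dominated:
  assumes a: "\<And>n. cmod (a n) < 1" and z: "cmod z < 1"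
  shows "cmod (b n * szego_kernel (a n) z) \<le> cmod (b n) / (1 - cmod z)"
  using mult_left_mono[OF norm_szego_kernel_le[OF a z], of "cmod (b n)"] by (simp add: norm_mult)

lemma summable_szego_series:
  assumes a: "\<And>n. cmod (a n) < 1" and b: "summable (\<lambda>n. cmod (b n))" and z: "cmod z < 1"
  shows "summable (\<lambda>n. b n * szego_kernel (a n) z)"
  using summable_divide[OF b] szego_series_dominated[OF a z]
  by (rule summable_comparison_test'[where N = 0])

lemma holomorphic_szego_series:
  assumes a: "\<And>n. cmod (a n) < 1" and b: "summable (\<lambda>n. cmod (b n))"
  shows "(\<lambda>z. \<Sum>n. b n * szego_kernel (a n) z) holomorphic_on ball 0 1"
proof (rule holomorphic_uniform_sequence)
  show "(\<lambda>z. \<Sum>n<N. b n * szego_kernel (a n) z) holomorphic_on ball 0 1" for N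
    by (intro holomorphic_intros holomorphic_szego_kernel a)
next
  fix z :: complex assume "z \<in> ball 0 1"
  \<comment> \<open>Half the distance from \<open>z\<close> to the circle: points of the closed disc
    of radius \<open>d\<close> around \<open>z\<close> keep distance at least \<open>d\<close> from
    the circle, which makes the kernels uniformly bounded there.\<close>
  define d where "d = (1 - cmod z) / 2"
  have d: "d > 0" using \<open>z \<in> ball 0 1\<close> by (simp add: d_def)
  have w: "cmod w \<le> 1 - d" if "w \<in> cball z d" for w
  proof -
    have "cmod (w - z) \<le> d" using that by (simp add: dist_norm norm_minus_commute)
    then show ?thesis using norm_triangle_ineq2[of w z] unfolding d_def by argo
  qed
  have "uniform_limit (cball z d) (\<lambda>N z. \<Sum>n<N. b n * szego_kernel (a n) z)
      (\<lambda>z. \<Sum>n. b n * szego_kernel (a n) z) sequentially"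
  proof (rule Weierstrass_m_test)
    show "cmod (b n * szego_kernel (a n) v) \<le> cmod (b n) / d" if "v \<in> cball z d" for n v
    proof -
      have "cmod (b n * szego_kernel (a n) v) \<le> cmod (b n) / (1 - cmod v)"
        by (rule szego_series_dominated) (use a d w[OF that] in auto)
      also have "\<dots> \<le> cmod (b n) / d"
        using d w[OF that] by (intro divide_left_mono) auto
      finally show ?thesis .
    qed
    show "summable (\<lambda>n. cmod (b n) / d)" using b by (rule summable_divide)
  qed
  moreover have "cball z d \<subseteq> ball 0 1" using w d by fastforce
  ultimately show "\<exists>d>0. cball z d \<subseteq> ball 0 1 \<and> uniform_limit (cball z d)
      (\<lambda>N z. \<Sum>n<N. b n * szego_kernel (a n) z) (\<lambda>z. \<Sum>n. b n * szego_kernel (a n) z) sequentially"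
    using d by blast
qed auto

text \<open>
  By the reproducing property, \<open>gram\<close> bounds the mean squares of all finite subsums uniformly in
  the radius. This gives membership in \<open>H\<^sup>2\<close>, and uniformity is what allows the limit \<open>r \<rightarrow> 1\<close> to be
  taken term by term in the scalar product with \<open>h\<close>.
\<close>

lemma szego_series_in_orth_compl:
  assumes a: "\<And>n. cmod (a n) < 1" and b: "summable (\<lambda>n. cmod (b n))" and E: "summable E"
    and gram: "\<And>r A. 0 \<le> r \<Longrightarrow> r < 1 \<Longrightarrow> finite A \<Longrightarrow>
      (\<Sum>n\<in>A. \<Sum>m\<in>A. cmod (b n) * cmod (b m) / cmod (1 - of_real (r\<^sup>2) * (cnj (a n) * a m))) \<le> sum E A"
    and M: "M \<subseteq> hardy_H2" and vanish: "\<And>h n. h \<in> M \<Longrightarrow> h (a n) = 0"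
  shows "(\<lambda>z. \<Sum>n. b n * szego_kernel (a n) z) \<in> hardy_orth_compl M"
proof -
  define f where "f z = (\<Sum>n. b n * szego_kernel (a n) z)" for z
  define F where "F A z = (\<Sum>n\<in>A. b n * szego_kernel (a n) z)" for A z
  have holF: "F A holomorphic_on ball 0 1" for A
    unfolding F_def[abs_def] by (intro holomorphic_intros holomorphic_szego_kernel a)
  \<comment> \<open>Comes from \<open>gram\<close> with one index and radius 0, where the left side
    is the square of \<open>cmod (b n)\<close>.\<close>
  have E_nonneg: "0 \<le> E n" for n
  proof -
    have "0 \<le> cmod (b n) * cmod (b n) / cmod (1 - of_real (0\<^sup>2) * (cnj (a n) * a n))" by simp
    also have "\<dots> \<le> E n" using gram[of 0 "{n}"] by simp
    finally show ?thesis .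
  qed
  have mean_F: "integral {0..2*pi} (\<lambda>t. (cmod (F A (of_real r * cis t)))\<^sup>2) \<le> 2*pi * sum E A"
    if "0 \<le> r" "r < 1" "finite A" for r A
  proof -
    have "integral {0..2*pi} (\<lambda>t. (cmod (F A (of_real r * cis t)))\<^sup>2) / (2*pi) \<le> sum E A"
      unfolding F_def
      by (rule order_trans[OF mean_square_szego_sum_le gram]) (use a that in auto)
    then show ?thesis by (simp add: field_simps)
  qed
  have lim_F: "(\<lambda>N. F {..<N} z) \<longlonglongrightarrow> f z" if "cmod z < 1" for z
    unfolding F_def f_def by (rule summable_LIMSEQ[OF summable_szego_series[OF a b that]])
  define C where "C r = (\<Sum>n. cmod (b n)) / (1 - r)" for r
  have bound_F: "cmod (F {..<N} z) \<le> C (cmod z)" if "cmod z < 1" for N z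
  proof -
    have "cmod (F {..<N} z) \<le> (\<Sum>n<N. cmod (b n) / (1 - cmod z))"
      unfolding F_def by (intro sum_norm_le szego_series_dominated a that)
    also have "\<dots> = (\<Sum>n<N. cmod (b n)) / (1 - cmod z)" by (simp add: sum_divide_distrib)
    also have "\<dots> \<le> C (cmod z)"
      unfolding C_def using that by (intro divide_right_mono sum_le_suminf b) auto
    finally show ?thesis .
  qed
  have circ: "cmod (of_real r * cis t) = r" if "0 \<le> r" for r t
    using that by (simp add: norm_mult)
  have cont_F: "continuous_on S (\<lambda>t. F A (of_real r * cis t))" if "0 \<le> r" "r < 1" for A r S
    by (rule continuous_on_circle[OF holF that])
  have mean_f: "integral {0..2*pi} (\<lambda>t. (cmod (f (of_real r * cis t)))\<^sup>2) / (2*pi) \<le> suminf E"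
    if r: "0 \<le> r" "r < 1" for r
  proof -
    \<comment> \<open>On a fixed circle the partial sums are bounded by \<open>C r\<close>
      independently of \<open>N\<close>, so the bound on their mean squares passes to the
      limit.\<close>
    have "(\<lambda>N. integral {0..2*pi} (\<lambda>t. (cmod (F {..<N} (of_real r * cis t)))\<^sup>2))
        \<longlonglongrightarrow> integral {0..2*pi} (\<lambda>t. (cmod (f (of_real r * cis t)))\<^sup>2)"
    proof (rule dominated_convergence)
      show "(\<lambda>t. (cmod (F {..<N} (of_real r * cis t)))\<^sup>2) integrable_on {0..2*pi}" for N
        by (intro integrable_continuous_interval continuous_intros cont_F r)
      show "norm ((cmod (F {..<N} (of_real r * cis t)))\<^sup>2) \<le> (C r)\<^sup>2" for N t
        using bound_F[of "of_real r * cis t" N] r by (simp add: circ power_mono)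
      show "(\<lambda>N. (cmod (F {..<N} (of_real r * cis t)))\<^sup>2) \<longlonglongrightarrow> (cmod (f (of_real r * cis t)))\<^sup>2" for t
        by (intro tendsto_intros lim_F) (use r in \<open>simp add: circ\<close>)
    qed auto
    then have "integral {0..2*pi} (\<lambda>t. (cmod (f (of_real r * cis t)))\<^sup>2) \<le> 2*pi * suminf E"
    proof (rule LIMSEQ_le_const2, intro exI[of _ 0] allI impI)
      fix N
      have "integral {0..2*pi} (\<lambda>t. (cmod (F {..<N} (of_real r * cis t)))\<^sup>2) \<le> 2*pi * sum E {..<N}"
        by (rule mean_F) (use r in auto)
      also have "sum E {..<N} \<le> suminf E" by (rule sum_le_suminf[OF E]) (use E_nonneg in auto)
      finally show "integral {0..2*pi} (\<lambda>t. (cmod (F {..<N} (of_real r * cis t)))\<^sup>2) \<le> 2*pi * suminf E"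
        by simp
    qed
    then show ?thesis by (simp add: field_simps)
  qed
  have "f \<in> hardy_H2"
    unfolding hardy_H2_def
  proof (intro CollectI conjI)
    show "f holomorphic_on ball 0 1"
      unfolding f_def[abs_def] by (rule holomorphic_szego_series[OF a b])
    show "bdd_above ((\<lambda>r. integral {0..2*pi} (\<lambda>t. (cmod (f (of_real r * cis t)))\<^sup>2) / (2*pi)) ` {0..<1})"
      using mean_f by (intro bdd_aboveI[of _ "suminf E"]) auto
  qed
  moreover have "hardy_inner f h = 0" if "h \<in> M" for h
  proof -
    from that M have "h \<in> hardy_H2" by blast
    then have holh: "h holomorphic_on ball 0 1"
      and bdd: "bdd_above ((\<lambda>r. integral {0..2*pi} (\<lambda>t. (cmod (h (of_real r * cis t)))\<^sup>2) / (2*pi)) ` {0..<1})"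
      by (auto simp: hardy_H2_def)
    from bdd obtain K0 where K0: "\<And>r. 0 \<le> r \<Longrightarrow> r < 1 \<Longrightarrow>
        integral {0..2*pi} (\<lambda>t. (cmod (h (of_real r * cis t)))\<^sup>2) / (2*pi) \<le> K0"
      by (fastforce simp: bdd_above_def)
    \<comment> \<open>The maximum with 0 makes \<open>K + 1\<close> visibly positive, as needed for
      the division in the choice of \<open>d\<close> below.\<close>
    define K where "K = max K0 0"
    have K: "integral {0..2*pi} (\<lambda>t. (cmod (h (of_real r * cis t)))\<^sup>2) \<le> 2*pi * K" if "0 \<le> r" "r < 1" for r
    proof -
      have "integral {0..2*pi} (\<lambda>t. (cmod (h (of_real r * cis t)))\<^sup>2) \<le> 2*pi * K0"
        using K0[OF that] by (simp add: field_simps)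
      also have "\<dots> \<le> 2*pi * K" by (simp add: K_def)
      finally show ?thesis .
    qed
    have cont_h: "continuous_on S (\<lambda>t. h (of_real r * cis t))" if "0 \<le> r" "r < 1" for r S
      by (rule continuous_on_circle[OF holh that])
    define P where "P A r = integral {0..2*pi} (\<lambda>t. F A (of_real r * cis t) * cnj (h (of_real r * cis t))) / (2*pi)"
      for A and r :: real
    define Q where "Q r = integral {0..2*pi} (\<lambda>t. f (of_real r * cis t) * cnj (h (of_real r * cis t))) / (2*pi)"
      for r :: real
    have P_eq: "P A r = (\<Sum>n\<in>A. b n * cnj (h (of_real (r\<^sup>2) * a n)))" if r: "0 \<le> r" "r < 1" and A: "finite A" for A r
    proof -
      have 1: "integral {0..2*pi} (\<lambda>t. szego_kernel (a n) (of_real r * cis t) * cnj (h (of_real r * cis t)))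
          = 2 * pi * cnj (h (of_real (r\<^sup>2) * a n))" for n
      proof -
        have "integral {0..2*pi} (\<lambda>t. szego_kernel (a n) (of_real r * cis t) * cnj (h (of_real r * cis t)))
          = cnj (integral {0..2*pi} (\<lambda>t. h (of_real r * cis t) * cnj (szego_kernel (a n) (of_real r * cis t))))"
          by (simp add: Henstock_Kurzweil_Integration.integral_cnj mult.commute)
        then show ?thesis using integral_mult_cnj_szego_kernel[OF holh r a] by simp
      qed
      have 2: "(\<lambda>t. szego_kernel (a n) (of_real r * cis t) * cnj (h (of_real r * cis t))) integrable_on {0..2*pi}" for n
        by (intro integrable_continuous_interval continuous_intros cont_h r
              continuous_on_circle[OF holomorphic_szego_kernel] a)
      have "integral {0..2*pi} (\<lambda>t. F A (of_real r * cis t) * cnj (h (of_real r * cis t)))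
          = integral {0..2*pi} (\<lambda>t. \<Sum>n\<in>A. b n * (szego_kernel (a n) (of_real r * cis t) * cnj (h (of_real r * cis t))))"
        by (simp add: F_def sum_distrib_right mult.assoc)
      also have "\<dots> = (\<Sum>n\<in>A. b n * (2 * pi * cnj (h (of_real (r\<^sup>2) * a n))))"
        using 1 2 A by (subst integral_sum) (auto intro: integrable_on_mult_right)
      finally show ?thesis
        by (simp add: P_def sum_divide_distrib)
    qed
    have lim_P: "(\<lambda>N. P {..<N} r) \<longlonglongrightarrow> Q r" if r: "0 \<le> r" "r < 1" for r
    proof -
      have "(\<lambda>N. integral {0..2*pi} (\<lambda>t. F {..<N} (of_real r * cis t) * cnj (h (of_real r * cis t))))
        \<longlonglongrightarrow> integral {0..2*pi} (\<lambda>t. f (of_real r * cis t) * cnj (h (of_real r * cis t)))"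
      proof (rule dominated_convergence)
        show "(\<lambda>t. F {..<N} (of_real r * cis t) * cnj (h (of_real r * cis t))) integrable_on {0..2*pi}" for N
          by (intro integrable_continuous_interval continuous_intros cont_F cont_h r)
        show "(\<lambda>t. C r * cmod (h (of_real r * cis t))) integrable_on {0..2*pi}"
          by (intro integrable_continuous_interval continuous_intros cont_h r)
        show "norm (F {..<N} (of_real r * cis t) * cnj (h (of_real r * cis t))) \<le> C r * cmod (h (of_real r * cis t))" for N t
          using bound_F[of "of_real r * cis t" N] r by (simp add: circ norm_mult mult_right_mono)
        show "(\<lambda>N. F {..<N} (of_real r * cis t) * cnj (h (of_real r * cis t)))
            \<longlonglongrightarrow> f (of_real r * cis t) * cnj (h (of_real r * cis t))" for t
          by (intro tendsto_intros lim_F) (use r in \<open>simp add: circ\<close>)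
      qed
      then show ?thesis unfolding P_def Q_def by (intro tendsto_intros) auto
    qed
    have P_le: "cmod (P A r) \<le> (sum E A / d + d * K) / 2" if r: "0 \<le> r" "r < 1" and A: "finite A" and d: "d > 0" for A r d
    proof -
      have "cmod (integral {0..2*pi} (\<lambda>t. F A (of_real r * cis t) * cnj (h (of_real r * cis t))))
        \<le> (integral {0..2*pi} (\<lambda>t. (cmod (F A (of_real r * cis t)))\<^sup>2) / d +
            d * integral {0..2*pi} (\<lambda>t. (cmod (h (of_real r * cis t)))\<^sup>2)) / 2"
        by (intro norm_integral_mult_cnj_le cont_F cont_h r d)
      also have "\<dots> \<le> (2*pi * sum E A / d + d * (2*pi * K)) / 2"
        using d r A by (intro divide_right_mono add_mono mult_left_mono mean_F K) auto
      also have "\<dots> = 2*pi * ((sum E A / d + d * K) / 2)" by (simp add: field_simps)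
      finally show ?thesis
        by (auto simp: P_def norm_divide norm_mult mult.commute intro!: mult_imp_div_pos_le)
    qed
    have "uniform_limit {0..<1} (\<lambda>N. P {..<N}) Q sequentially"
    proof (rule uniform_limitI)
      fix e :: real assume "e > 0"
      \<comment> \<open>With a block of \<open>E\<close> below d^2, the bound \<open>P_le\<close>
        becomes at most d (K + 1) / 2, and this choice turns it into e / 2, independently of
        \<open>r\<close>.\<close>
      define d where "d = e / (K + 1)"
      have d: "d > 0" and K0: "K \<ge> 0" using \<open>e > 0\<close> by (auto simp: d_def K_def)
      obtain N0 where N0: "\<And>m n. m \<ge> N0 \<Longrightarrow> norm (sum E {m..<n}) < d\<^sup>2"
        using E[unfolded summable_Cauchy, rule_format, of "d\<^sup>2"] d by auto
      have "dist (P {..<N} r) (Q r) < e" if "N \<ge> N0" "r \<in> {0..<1}" for N r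
      proof -
        from that have r: "0 \<le> r" "r < 1" by auto
        have "cmod (P {..<N} r - P {..<N'} r) \<le> e / 2" if "N' \<ge> N" for N'
        proof -
          have "P {..<N'} r = P {..<N} r + P {N..<N'} r"
            using r that by (simp add: P_eq sum.atLeastLessThan_concat lessThan_atLeast0)
          then have "cmod (P {..<N} r - P {..<N'} r) = cmod (P {N..<N'} r)" by simp
          also have "\<dots> \<le> (sum E {N..<N'} / d + d * K) / 2" by (intro P_le r d) auto
          also have "\<dots> \<le> (d\<^sup>2 / d + d * K) / 2"
            using N0[OF \<open>N \<ge> N0\<close>, of N'] d by (intro divide_right_mono add_mono) auto
          also have "\<dots> = d * (K + 1) / 2" using d by (simp add: power2_eq_square field_simps)
          also have "\<dots> = e / 2" using K0 by (simp add: d_def)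
          finally show ?thesis .
        qed
        then have "cmod (P {..<N} r - Q r) \<le> e / 2"
          by (intro LIMSEQ_le_const2[OF tendsto_norm[OF tendsto_diff[OF tendsto_const lim_P[OF r]]]]) blast
        with \<open>e > 0\<close> show ?thesis by (simp add: dist_norm)
      qed
      then show "\<forall>\<^sub>F N in sequentially. \<forall>r\<in>{0..<1}. dist (P {..<N} r) (Q r) < e"
        by (auto intro!: eventually_sequentiallyI[of N0])
    qed
    \<comment> \<open>For finitely many terms the limit is evaluated directly: r^2 a_n tends to a_n
      inside the disc, where \<open>h\<close> is continuous and vanishes.\<close>
    moreover have "(P {..<N} \<longlongrightarrow> 0) (at_left 1)" for N
    proof -
      have ev: "\<forall>\<^sub>F r in at_left (1::real). 0 \<le> r \<and> r < 1"
        by (rule eventually_at_leftI[of 0]) auto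
      have "((\<lambda>r. \<Sum>n<N. b n * cnj (h (of_real (r\<^sup>2) * a n))) \<longlongrightarrow> (\<Sum>n<N. b n * cnj (h (of_real (1\<^sup>2) * a n)))) (at_left 1)"
      proof (intro tendsto_intros)
        fix n
        have "isCont h (of_real (1\<^sup>2) * a n)"
          using holomorphic_on_imp_continuous_on[OF holh] a[of n] by (simp add: continuous_on_eq_continuous_at)
        moreover have "((\<lambda>r. of_real (r\<^sup>2) * a n) \<longlongrightarrow> of_real (1\<^sup>2) * a n) (at_left 1)"
          by (intro tendsto_intros)
        ultimately show "((\<lambda>r. h (of_real (r\<^sup>2) * a n)) \<longlongrightarrow> h (of_real (1\<^sup>2) * a n)) (at_left 1)"
          by (rule isCont_tendsto_compose)
      qed
      also have "(\<Sum>n<N. b n * cnj (h (of_real (1\<^sup>2) * a n))) = 0"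
        using vanish[OF \<open>h \<in> M\<close>] by simp
      finally show ?thesis
        by (rule Lim_transform_eventually) (use ev in \<open>eventually_elim, simp add: P_eq\<close>)
    qed
    moreover have "\<forall>\<^sub>F r in at_left 1. r \<in> {0..<1::real}"
      by (rule eventually_at_leftI[of 0]) auto
    \<comment> \<open>Uniform convergence in \<open>r\<close> permits exchanging the limits in
      \<open>N\<close> and in \<open>r\<close>; every partial sum has limit 0 as \<open>r\<close>
      tends to 1, hence so has \<open>Q\<close>.\<close>
    ultimately have "(Q \<longlongrightarrow> 0) (at_left 1)"
      using swap_uniform_limit'[of "\<lambda>N. P {..<N}" "\<lambda>_. 0" "at_left 1" sequentially 0 "{0..<1}" Q]
      by simp
    then show ?thesis
      unfolding hardy_inner_def Q_def[abs_def] by (intro tendsto_Lim trivial_limit_at_left_real)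
  qed
  ultimately show ?thesis unfolding hardy_orth_compl_def f_def[abs_def] by blast
qed

section \<open>Blaschke products\<close>

lemma norm_blaschke_factor_le_1:
  assumes "cmod a < 1" "cmod z < 1"
  shows "cmod (blaschke_factor a z) \<le> 1"
proof (cases "a = 0")
  case True
  then show ?thesis using assms by (simp add: blaschke_factor_def)
next
  case False
  then have "cmod (blaschke_factor a z) = cmod (Moebius_function 0 a z)"
    by (simp add: blaschke_factor_def Moebius_function_def norm_mult norm_divide norm_minus_commute)
  then show ?thesis using Moebius_function_norm_lt_1[OF assms, of 0] by simp
qed

lemma holomorphic_blaschke_factor:
  assumes "cmod a < 1"
  shows "blaschke_factor a holomorphic_on ball 0 1"
proof (cases "a = 0")
  case True
  then show ?thesis by (simp add: blaschke_factor_def[abs_def])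
next
  case False
  then show ?thesis
    unfolding blaschke_factor_def[abs_def]
    using norm_one_minus_cnj_mult[OF assms] by (auto intro!: holomorphic_intros)
qed

text \<open>Over the common denominator a D, with D = 1 - cnj a z, the numerator factors as -(1 -
  |a|) (a + |a| z), and the second factor is at most 2 |a| in modulus. Thus the Blaschke condition
  becomes absolute convergence of the product, uniformly on compact subsets of the disc.\<close>

lemma norm_blaschke_factor_minus_1_le:
  assumes a: "cmod a < 1" and z: "cmod z < 1"
  shows "cmod (blaschke_factor a z - 1) \<le> 2 * (1 - cmod a) / (1 - cmod z)"
proof (cases "a = 0")
  case True
  have "cmod (z - 1) \<le> 2"
    using norm_triangle_ineq4[of z 1] z by simp
  also have "\<dots> \<le> 2 / (1 - cmod z)" using z by (simp add: field_simps)
  finally show ?thesis using True by (simp add: blaschke_factor_def)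
next
  case False
  define D where "D = 1 - cnj a * z"
  have D: "1 - cmod z \<le> cmod D" "D \<noteq> 0"
    unfolding D_def by (rule norm_one_minus_cnj_mult[OF a z])+
  have aa: "a * cnj a = of_real (cmod a) * of_real (cmod a)"
    using complex_norm_square[of a] by (simp add: power2_eq_square)
  have "blaschke_factor a z = of_real (cmod a) * (a - z) / (a * D)"
    using False by (simp add: blaschke_factor_def D_def)
  then have "blaschke_factor a z - 1 = (of_real (cmod a) * (a - z) - a * D) / (a * D)"
    using False D by (simp add: diff_divide_distrib)
  also have "of_real (cmod a) * (a - z) - a * D = - (of_real (1 - cmod a)) * (a + of_real (cmod a) * z)"
    unfolding D_def of_real_diff of_real_1 using aa by algebra
  finally have "cmod (blaschke_factor a z - 1)
      = (1 - cmod a) * cmod (a + of_real (cmod a) * z) / (cmod a * cmod D)"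
    using a by (simp add: norm_mult norm_divide del: of_real_diff)
  also have "\<dots> \<le> (1 - cmod a) * (2 * cmod a) / (cmod a * cmod D)"
  proof (intro divide_right_mono mult_left_mono)
    have "cmod (a + of_real (cmod a) * z) \<le> cmod a + cmod a * cmod z"
      using norm_triangle_ineq[of a "of_real (cmod a) * z"] by (simp add: norm_mult)
    also have "cmod a * cmod z \<le> cmod a" using z by (intro mult_left_le) auto
    finally show "cmod (a + of_real (cmod a) * z) \<le> 2 * cmod a" by simp
  qed (use a in auto)
  also have "\<dots> = 2 * (1 - cmod a) / cmod D" using False by simp
  also have "\<dots> \<le> 2 * (1 - cmod a) / (1 - cmod z)"
    using D z a by (intro divide_left_mono mult_pos_pos) auto
  finally show ?thesis .
qed

context
  fixes a :: "nat \<Rightarrow> complex"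
  assumes a: "\<And>n. cmod (a n) < 1" and blaschke: "summable (\<lambda>n. 1 - cmod (a n))"
begin

lemma has_prod_blaschke_product:
  assumes z: "cmod z < 1"
  shows "(\<lambda>n. blaschke_factor (a n) z) has_prod blaschke_product a z"
proof -
  have "summable (\<lambda>n. 2 / (1 - cmod z) * (1 - cmod (a n)))"
    using blaschke by (rule summable_mult)
  then have "summable (\<lambda>n. norm (blaschke_factor (a n) z - 1))"
    by (rule summable_comparison_test'[where N = 0])
       (use norm_blaschke_factor_minus_1_le[OF a z] in auto)
  then have "convergent_prod (\<lambda>n. blaschke_factor (a n) z)"
    by (intro abs_convergent_prod_imp_convergent_prod summable_imp_abs_convergent_prod)
  then show ?thesis
    unfolding blaschke_product_def by (rule convergent_prod_has_prod)
qed

lemma blaschke_product_zero: "blaschke_product a (a n) = 0"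
proof -
  have "blaschke_factor (a n) (a n) = 0" by (simp add: blaschke_factor_def)
  then have "0 \<in> range (\<lambda>k. blaschke_factor (a k) (a n))" by (metis rangeI)
  then show ?thesis
    using has_prod_eq_0_iff[OF has_prod_blaschke_product[OF a]] by blast
qed

lemma norm_blaschke_product_le_1:
  assumes z: "cmod z < 1"
  shows "cmod (blaschke_product a z) \<le> 1"
proof (rule LIMSEQ_le_const2)
  show "(\<lambda>N. cmod (\<Prod>n<N. blaschke_factor (a n) z)) \<longlonglongrightarrow> cmod (blaschke_product a z)"
    by (intro tendsto_norm has_prod_imp_tendsto' has_prod_blaschke_product z)
  show "\<exists>N. \<forall>n\<ge>N. cmod (\<Prod>k<n. blaschke_factor (a k) z) \<le> 1"
    by (auto simp: prod_norm[symmetric] intro!: prod_le_1 norm_blaschke_factor_le_1 a z)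
qed

lemma holomorphic_blaschke_product: "blaschke_product a holomorphic_on ball 0 1"
proof (rule holomorphic_uniform_sequence)
  show "(\<lambda>z. \<Prod>n<N. blaschke_factor (a n) z) holomorphic_on ball 0 1" for N
    by (intro holomorphic_intros holomorphic_blaschke_factor a)
next
  fix z :: complex assume "z \<in> ball 0 1"
  define d where "d = (1 - cmod z) / 2"
  have d: "d > 0" using \<open>z \<in> ball 0 1\<close> by (simp add: d_def)
  have w: "cmod w \<le> 1 - d" if "w \<in> cball z d" for w
  proof -
    have "cmod (w - z) \<le> d" using that by (simp add: dist_norm norm_minus_commute)
    then show ?thesis using norm_triangle_ineq2[of w z] unfolding d_def by argo
  qed
  then have sub: "cball z d \<subseteq> ball 0 1" using d by fastforce
  have "uniformly_convergent_on (cball z d) (\<lambda>N w. \<Prod>n<N. blaschke_factor (a n) w)"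
  proof (rule uniformly_convergent_on_prod')
    show "continuous_on (cball z d) (blaschke_factor (a n))" for n
      using continuous_on_subset[OF holomorphic_on_imp_continuous_on[OF holomorphic_blaschke_factor[OF a]] sub] .
    show "uniformly_convergent_on (cball z d) (\<lambda>N w. \<Sum>n<N. norm (blaschke_factor (a n) w - 1))"
    proof (rule Weierstrass_m_test')
      show "summable (\<lambda>n. 2 / d * (1 - cmod (a n)))" using blaschke by (rule summable_mult)
      show "norm (norm (blaschke_factor (a n) v - 1)) \<le> 2 / d * (1 - cmod (a n))" if "v \<in> cball z d" for n v
      proof -
        have "cmod (blaschke_factor (a n) v - 1) \<le> 2 * (1 - cmod (a n)) / (1 - cmod v)"
          by (rule norm_blaschke_factor_minus_1_le) (use a d w[OF that] in auto)
        also have "\<dots> \<le> 2 * (1 - cmod (a n)) / d"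
          using d w[OF that] a[of n] by (intro divide_left_mono) auto
        finally show ?thesis by simp
      qed
    qed
  qed auto
  then obtain g where g: "uniform_limit (cball z d) (\<lambda>N w. \<Prod>n<N. blaschke_factor (a n) w) g sequentially"
    by (auto simp: uniformly_convergent_on_def)
  \<comment> \<open>Uniform convergence of the products only yields some limit \<open>g\<close>;
    pointwise uniqueness of limits identifies it with the Blaschke product.\<close>
  have "g v = blaschke_product a v" if "v \<in> cball z d" for v
  proof (rule LIMSEQ_unique)
    show "(\<lambda>N. \<Prod>n<N. blaschke_factor (a n) v) \<longlonglongrightarrow> g v"
      by (rule tendsto_uniform_limitI[OF g that])
    show "(\<lambda>N. \<Prod>n<N. blaschke_factor (a n) v) \<longlonglongrightarrow> blaschke_product a v"
      using that sub by (intro has_prod_imp_tendsto' has_prod_blaschke_product) auto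
  qed
  then have "uniform_limit (cball z d) (\<lambda>N w. \<Prod>n<N. blaschke_factor (a n) w) (blaschke_product a) sequentially"
    using g by (metis (mono_tags, lifting) uniform_limit_cong')
  then show "\<exists>d>0. cball z d \<subseteq> ball 0 1 \<and>
      uniform_limit (cball z d) (\<lambda>N z. \<Prod>n<N. blaschke_factor (a n) z) (blaschke_product a) sequentially"
    using d sub by blast
qed auto

end

text \<open>A multiplier of modulus at most 1 cannot increase mean squares. This lets
  \<open>mult_H2 B\<close> serve as the set \<open>M\<close> in
  \<open>szego_series_in_orth_compl\<close>.\<close>

lemma mult_H2_subset_hardy_H2:
  assumes B: "B holomorphic_on ball 0 1" and le: "\<And>z. cmod z < 1 \<Longrightarrow> cmod (B z) \<le> 1"
  shows "mult_H2 B \<subseteq> hardy_H2"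
proof
  fix h assume "h \<in> mult_H2 B"
  then obtain g where h: "h = (\<lambda>z. B z * g z)" and "g \<in> hardy_H2" by (auto simp: mult_H2_def)
  then have g: "g holomorphic_on ball 0 1"
    and bdd: "bdd_above ((\<lambda>r. integral {0..2*pi} (\<lambda>t. (cmod (g (of_real r * cis t)))\<^sup>2) / (2*pi)) ` {0..<1})"
    by (auto simp: hardy_H2_def)
  from B g have hol: "h holomorphic_on ball 0 1" unfolding h by (intro holomorphic_intros)
  have "integral {0..2*pi} (\<lambda>t. (cmod (h (of_real r * cis t)))\<^sup>2)
      \<le> integral {0..2*pi} (\<lambda>t. (cmod (g (of_real r * cis t)))\<^sup>2)" if r: "0 \<le> r" "r < 1" for r
  proof (rule integral_le)
    show "(cmod (h (of_real r * cis t)))\<^sup>2 \<le> (cmod (g (of_real r * cis t)))\<^sup>2" for t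
      using mult_right_mono[OF le[of "of_real r * cis t"], of "cmod (g (of_real r * cis t))"] r
      by (intro power_mono) (auto simp: h norm_mult)
  qed (intro integrable_continuous_interval continuous_intros continuous_on_circle[OF _ r] hol g)+
  then have "integral {0..2*pi} (\<lambda>t. (cmod (h (of_real r * cis t)))\<^sup>2) / (2*pi)
      \<le> integral {0..2*pi} (\<lambda>t. (cmod (g (of_real r * cis t)))\<^sup>2) / (2*pi)" if "r \<in> {0..<1}" for r
    using that by (intro divide_right_mono) auto
  moreover obtain K where "\<And>r. r \<in> {0..<1} \<Longrightarrow>
      integral {0..2*pi} (\<lambda>t. (cmod (g (of_real r * cis t)))\<^sup>2) / (2*pi) \<le> K"
    using bdd by (auto simp only: bdd_above_def ball_simps)
  ultimately have "bdd_above ((\<lambda>r. integral {0..2*pi} (\<lambda>t. (cmod (h (of_real r * cis t)))\<^sup>2) / (2*pi)) ` {0..<1})"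
    by (intro bdd_aboveI2[where M = K]) (rule order_trans)
  with hol show "h \<in> hardy_H2" by (simp add: hardy_H2_def)
qed

section \<open>Elementary estimates\<close>

text \<open>Since 1 < pi / 3, the derivative cos u - 1/2 of sin u - u/2 is nonnegative on
  [0, 1].\<close>

lemma half_le_sin:
  fixes t :: real
  assumes "0 \<le> t" "t \<le> 1"
  shows "t / 2 \<le> sin t"
proof -
  have "sin 0 - 0 / 2 \<le> sin t - t / 2"
  proof (rule DERIV_nonneg_imp_nondecreasing[OF assms(1)])
    fix u :: real assume "0 \<le> u" "u \<le> t"
    then have "cos (pi / 3) \<le> cos u"
      using assms pi_gt3 by (intro cos_monotone_0_pi_le) auto
    then have "0 \<le> cos u - 1 / 2" by (simp add: cos_60)
    moreover have "((\<lambda>u. sin u - u / 2) has_real_derivative cos u - 1 / 2) (at u)"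
      by (auto intro!: derivative_eq_intros)
    ultimately show "\<exists>y. ((\<lambda>u. sin u - u / 2) has_real_derivative y) (at u) \<and> 0 \<le> y" by blast
  qed
  then show ?thesis by simp
qed

text \<open>The distance from \<open>1\<close> to the line through \<open>0\<close> and \<open>cis t\<close> is \<open>\<bar>sin t\<bar>\<close>.\<close>

lemma abs_sin_le_norm_one_minus_cis: "\<bar>sin t\<bar> \<le> cmod (1 - of_real c * cis t)"
proof -
  have "(cmod (1 - of_real c * cis t))\<^sup>2 = (1 - c * cos t)\<^sup>2 + (c * sin t)\<^sup>2"
    by (simp add: cmod_power2)
  also have "\<dots> = (sin t)\<^sup>2 + (c - cos t)\<^sup>2"
    using sin_cos_squared_add[of t] by algebra
  finally have "(sin t)\<^sup>2 \<le> (cmod (1 - of_real c * cis t))\<^sup>2" by simp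
  then show ?thesis by (metis abs_le_square_iff abs_norm_cancel)
qed

lemma norm_one_minus_cis_le: "cmod (1 - cis t) \<le> \<bar>t\<bar>"
proof -
  have "cmod (1 - cis t) = 2 * \<bar>sin (t / 2)\<bar>"
    using dist_exp_i_1[of t] by (simp add: norm_minus_commute cis_conv_exp)
  then show ?thesis using abs_sin_x_le_abs_x[of "t / 2"] by simp
qed

text \<open>With w = cnj a z the quantity is -Im w / |1 - w|^2. Closeness of \<open>z\<close> to 1
  on the scale \<tau> keeps -Im w at least of order \<tau>, and tangency 1 - \<rho> \<le> X \<tau>
  keeps |1 - w| at most of order \<tau>, so the quotient has order 1 / \<tau>.\<close>

lemma neg_Im_szego_kernel_ge:
  assumes rho: "0 < \<rho>" "\<rho> \<le> 1" "1 - \<rho> \<le> X * \<tau>" and tau: "0 < \<tau>" "\<tau> \<le> 1/2" and X: "0 \<le> X"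
    and z: "cmod z < 1" "cmod (1 - z) \<le> \<tau> / 16"
  shows "\<rho> / (8 * (2 + X)\<^sup>2 * \<tau>) \<le> - Im (szego_kernel (of_real \<rho> * cis \<tau>) z)"
proof -
  define w where "w = cnj (of_real \<rho> * cis \<tau>) * z"
  have Re_z: "1 / 2 \<le> Re z" and Im_z: "\<bar>Im z\<bar> \<le> \<tau> / 16"
    using z(2) tau abs_Re_le_cmod[of "1 - z"] abs_Im_le_cmod[of "1 - z"] by auto
  \<comment> \<open>The term sin \<tau> Re z is at least \<tau>/4 and the competing cos \<tau> Im z
    at most \<tau>/16; the difference exceeds \<tau>/8.\<close>
  have Im_w: "\<rho> * \<tau> / 8 \<le> - Im w"
  proof -
    have "\<tau> / 2 * (1 / 2) \<le> sin \<tau> * Re z"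
      using half_le_sin[of \<tau>] tau Re_z by (intro mult_mono) auto
    moreover have "cos \<tau> * Im z \<le> \<tau> / 16"
    proof -
      have "cos \<tau> * Im z \<le> \<bar>cos \<tau>\<bar> * \<bar>Im z\<bar>" by (metis abs_ge_self abs_mult)
      also have "\<dots> \<le> 1 * \<bar>Im z\<bar>" by (intro mult_right_mono) auto
      finally show ?thesis using Im_z by simp
    qed
    ultimately have "\<tau> / 8 \<le> sin \<tau> * Re z - cos \<tau> * Im z" using tau by simp
    then have "\<rho> * (\<tau> / 8) \<le> \<rho> * (sin \<tau> * Re z - cos \<tau> * Im z)"
      using rho by (intro mult_left_mono) auto
    also have "\<dots> = - Im w" by (simp add: w_def algebra_simps)
    finally show ?thesis by simp
  qed
  have norm_le: "cmod (1 - w) \<le> (2 + X) * \<tau>"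
  proof -
    \<comment> \<open>Splits the distance into that of \<open>z\<close> from 1, the radial defect 1
      - \<rho> and the angular defect of cis (-\<tau>).\<close>
    have "1 - w = (1 - z) + z * (of_real (1 - \<rho>) + of_real \<rho> * (1 - cis (- \<tau>)))"
      by (simp add: w_def cis_cnj algebra_simps)
    also have "cmod \<dots> \<le> cmod (1 - z) + cmod z * (cmod (of_real (1 - \<rho>)) + cmod (of_real \<rho>) * cmod (1 - cis (- \<tau>)))"
      by (metis (no_types) norm_triangle_ineq norm_mult norm_triangle_le add_left_mono mult_left_mono norm_ge_zero)
    also have "\<dots> \<le> \<tau> / 16 + 1 * (X * \<tau> + 1 * \<tau>)"
      using norm_one_minus_cis_le[of "- \<tau>"] z rho tau X
      by (intro add_mono mult_mono) (auto simp del: of_real_diff)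
    also have "\<dots> \<le> (2 + X) * \<tau>" using tau by (simp add: algebra_simps)
    finally show ?thesis .
  qed
  have pos: "0 < cmod (1 - w)"
    using Im_w rho tau by (auto simp: complex_eq_iff mult_pos_pos) (smt (verit) mult_pos_pos)
  have "\<rho> / (8 * (2 + X)\<^sup>2 * \<tau>) = (\<rho> * \<tau> / 8) / ((2 + X) * \<tau>)\<^sup>2"
    using tau X by (simp add: power2_eq_square)
  also have "\<dots> \<le> (- Im w) / (cmod (1 - w))\<^sup>2"
  proof (intro frac_le power_mono)
    have "0 \<le> \<rho> * \<tau> / 8" using rho tau by simp
    then show "0 \<le> - Im w" using Im_w by linarith
  qed (use Im_w norm_le pos in auto)
  also have "\<dots> = - Im (szego_kernel (of_real \<rho> * cis \<tau>) z)"
  proof -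
    have "Im (1 / (1 - w)) = Im w / (cmod (1 - w))\<^sup>2"
      by (simp add: Im_divide cmod_power2)
    moreover have "szego_kernel (of_real \<rho> * cis \<tau>) z = 1 / (1 - w)"
      by (simp add: szego_kernel_def w_def)
    ultimately show ?thesis by (simp only: minus_divide_left)
  qed
  finally show ?thesis .
qed

text \<open>An off-diagonal entry is charged to its larger index. A natural number m has at most m
  smaller indices, so each of the two triangles costs at most m c_m.\<close>

lemma double_sum_le_weighted_diagonal:
  fixes T :: "nat \<Rightarrow> nat \<Rightarrow> real"
  assumes A: "finite A" and c: "\<And>n. 0 \<le> c n"
    and diag: "\<And>n. T n n \<le> e n" and upper: "\<And>n m. n < m \<Longrightarrow> T n m \<le> c m"
    and lower: "\<And>n m. m < n \<Longrightarrow> T n m \<le> c n"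
  shows "(\<Sum>n\<in>A. \<Sum>m\<in>A. T n m) \<le> (\<Sum>n\<in>A. e n + 2 * (real n * c n))"
proof -
  have row: "(\<Sum>n\<in>A. if n < m then c m else 0) \<le> real m * c m" for m
  proof -
    have "(\<Sum>n\<in>A. if n < m then c m else 0) = real (card {n \<in> A. n < m}) * c m"
      using A by (simp add: sum.If_cases Int_def)
    moreover have "card {n \<in> A. n < m} \<le> card {..<m}" by (intro card_mono) auto
    ultimately show ?thesis using c[of m] by (auto intro!: mult_right_mono)
  qed
  have "(\<Sum>n\<in>A. \<Sum>m\<in>A. T n m) \<le> (\<Sum>n\<in>A. \<Sum>m\<in>A. (if n = m then e n else 0) +
      (if n < m then c m else 0) + (if m < n then c n else 0))"
  proof (intro sum_mono)
    fix n m
    show "T n m \<le> (if n = m then e n else 0) + (if n < m then c m else 0) + (if m < n then c n else 0)"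
      using diag[of n] upper[of n m] lower[of m n] by (cases n m rule: linorder_cases) auto
  qed
  also have "\<dots> = (\<Sum>n\<in>A. e n) + (\<Sum>n\<in>A. \<Sum>m\<in>A. if n < m then c m else 0) +
      (\<Sum>n\<in>A. \<Sum>m\<in>A. if m < n then c n else 0)"
    using A by (simp add: sum.distrib)
  also have "(\<Sum>n\<in>A. \<Sum>m\<in>A. if n < m then c m else 0) = (\<Sum>m\<in>A. \<Sum>n\<in>A. if n < m then c m else 0)"
    by (rule sum.swap)
  also have "(\<Sum>n\<in>A. e n) + (\<Sum>m\<in>A. \<Sum>n\<in>A. if n < m then c m else 0) +
      (\<Sum>n\<in>A. \<Sum>m\<in>A. if m < n then c n else 0) \<le>
      (\<Sum>n\<in>A. e n) + (\<Sum>m\<in>A. real m * c m) + (\<Sum>n\<in>A. real n * c n)"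
    by (intro add_mono sum_mono row order_refl)
  also have "\<dots> = (\<Sum>n\<in>A. e n + 2 * (real n * c n))"
    by (simp add: sum.distrib sum_distrib_left[symmetric])
  finally show ?thesis .
qed

text \<open>Mean value theorem for -(ln t)^(-\<epsilon>) / \<epsilon>: its derivative 1 / (t (ln
  t)^(1+\<epsilon>)) decreases, so at the intermediate point it dominates the value at
  \<open>v\<close>. The bound \<open>exp 1 \<le> u\<close> keeps all logarithms at least 1.\<close>

lemma increment_le_log_power_difference:
  fixes u v \<epsilon> :: real
  assumes "exp 1 \<le> u" "u \<le> v" "\<epsilon> > 0"
  shows "(v - u) / (v * ln v powr (1 + \<epsilon>)) \<le> (ln u powr (-\<epsilon>) - ln v powr (-\<epsilon>)) / \<epsilon>"
proof (cases "u = v")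
  case False
  with assms have uv: "u < v" by simp
  have gt: "exp 1 > (1::real)" by simp
  have ln_ge: "ln t \<ge> 1" "t > 1" if "t \<ge> u" for t
  proof -
    show "t > 1" using that assms gt by linarith
    then show "ln t \<ge> 1" using that assms by (simp add: ln_ge_iff)
  qed
  have "\<exists>t. u < t \<and> t < v \<and> (- (ln v powr (-\<epsilon>) / \<epsilon>)) - (- (ln u powr (-\<epsilon>) / \<epsilon>)) =
      (v - u) * (ln t powr (-\<epsilon> - 1) / t)"
  proof (rule MVT2[OF uv])
    fix t assume "u \<le> t" "t \<le> v"
    then have "ln t > 0" "t > 0" using ln_ge[of t] by auto
    then show "((\<lambda>t. - (ln t powr (-\<epsilon>) / \<epsilon>)) has_real_derivative ln t powr (-\<epsilon> - 1) / t) (at t)"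
      using assms(3) by (auto intro!: derivative_eq_intros simp: powr_diff field_simps)
  qed
  then obtain t where t: "u < t" "t < v"
    and eq: "(- (ln v powr (-\<epsilon>) / \<epsilon>)) - (- (ln u powr (-\<epsilon>) / \<epsilon>)) = (v - u) * (ln t powr (-\<epsilon> - 1) / t)" by blast
  have t1: "ln t \<ge> 1" "t > 1" using ln_ge[of t] t by auto
  have "1 / (v * ln v powr (1 + \<epsilon>)) \<le> 1 / (t * ln t powr (1 + \<epsilon>))"
    using t t1 assms(3) by (intro divide_left_mono mult_mono powr_mono2 mult_pos_pos) auto
  also have "\<dots> = ln t powr (-\<epsilon> - 1) / t"
  proof -
    have *: "- \<epsilon> - 1 = - (1 + \<epsilon>)" by simp
    show ?thesis unfolding * powr_minus_divide by simp
  qed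
  finally have "(v - u) * (1 / (v * ln v powr (1 + \<epsilon>))) \<le> (v - u) * (ln t powr (-\<epsilon> - 1) / t)"
    using uv by (intro mult_left_mono) auto
  with eq show ?thesis by (simp add: diff_divide_distrib)
qed simp

text \<open>A telescoping form of the integral test. Evaluating the denominator at the right
  endpoint gives a lower Riemann sum, so increments of any size are allowed.\<close>

lemma summable_increments_log_power:
  fixes S :: "nat \<Rightarrow> real"
  assumes S: "mono S" "exp 1 \<le> S 0" and eps: "\<epsilon> > 0"
  shows "summable (\<lambda>k. (S (Suc k) - S k) / (S (Suc k) * ln (S (Suc k)) powr (1 + \<epsilon>)))"
proof (rule summableI_nonneg_bounded)
  have ge: "exp 1 \<le> S k" for k using S(1)[THEN monoD, of 0 k] S(2) by simp
  have le: "S k \<le> S (Suc k)" for k using S(1)[THEN monoD, of k "Suc k"] by simp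
  have pos: "0 < S k" for k using ge[of k] by (meson exp_gt_zero less_le_trans)
  show "0 \<le> (S (Suc k) - S k) / (S (Suc k) * ln (S (Suc k)) powr (1 + \<epsilon>))" for k
    using le[of k] pos[of "Suc k"] by simp
  show "(\<Sum>k<n. (S (Suc k) - S k) / (S (Suc k) * ln (S (Suc k)) powr (1 + \<epsilon>)))
      \<le> ln (S 0) powr (-\<epsilon>) / \<epsilon>" for n
  proof -
    have "(\<Sum>k<n. (S (Suc k) - S k) / (S (Suc k) * ln (S (Suc k)) powr (1 + \<epsilon>)))
        \<le> (\<Sum>k<n. (ln (S k) powr (-\<epsilon>) - ln (S (Suc k)) powr (-\<epsilon>)) / \<epsilon>)"
      by (intro sum_mono increment_le_log_power_difference ge le eps)
    also have "\<dots> = (ln (S 0) powr (-\<epsilon>) - ln (S n) powr (-\<epsilon>)) / \<epsilon>"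
      using sum_lessThan_telescope'[of "\<lambda>k. ln (S k) powr (-\<epsilon>)" n] by (simp add: sum_divide_distrib[symmetric])
    also have "\<dots> \<le> ln (S 0) powr (-\<epsilon>) / \<epsilon>"
      using eps by (intro divide_right_mono) auto
    finally show ?thesis .
  qed
qed

text \<open>Both square-root expressions are asymptotic to sqrt (s / (ln s)^p), which tends to
  infinity; the loss of the factor 1/4 absorbs the shifts by \<open>exp 1\<close> and
  \<open>Q\<close> and the constant \<open>R\<close>.\<close>

lemma eventually_sqrt_log_power_comparison:
  fixes c p Q R :: real
  assumes "c > 0" "p > 0"
  shows "\<forall>\<^sub>F s in at_top. c / 4 * sqrt ((s + Q) / ln s powr p) \<le>
    c * (s / sqrt ((exp 1 + s) * ln (exp 1 + s) powr p)) - R"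
  using assms by real_asymp

section \<open>Zeros approaching 1 tangentially\<close>

text \<open>The zero of index k + 1, renumbered from 0, with \<open>y k\<close> for x_(k+1) and
  4^(k+1) for 2^(2(k+1)). Its distance to the circle is \<open>y k\<close> times the square of its
  argument, whence the tangential approach.\<close>

definition tangential_zero :: "(nat \<Rightarrow> real) \<Rightarrow> nat \<Rightarrow> complex" where
  "tangential_zero y k = of_real (1 - y k / 4 ^ Suc k) * cis (1 / 2 ^ Suc k)"

lemma norm_tangential_zero:
  assumes "0 < y k" "y k / 4 ^ Suc k < 1"
  shows "cmod (tangential_zero y k) = 1 - y k / 4 ^ Suc k"
  using assms unfolding tangential_zero_def norm_mult norm_of_real norm_cis by simp

lemma summable_half_power_Suc: "summable (\<lambda>k. c / 2 ^ Suc k :: real)"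
  using summable_mult[OF summable_geometric[of "1/2 :: real"], of "c / 2"] by (simp add: power_one_over field_simps)

lemma summable_weighted_half_power_Suc: "summable (\<lambda>k. 2 * (real k * (c / 2 ^ Suc k)))"
proof -
  have "summable (\<lambda>n. real (Suc n) * (1/2) ^ n)"
    using geometric_deriv_sums[of "1/2 :: real"] by (auto simp: sums_iff)
  then have "summable (\<lambda>n. c * (real (Suc n) * (1/2) ^ n) - c * (1/2) ^ n)"
    by (intro summable_diff summable_mult summable_geometric) auto
  moreover have "c * (real (Suc n) * (1/2) ^ n) - c * (1/2) ^ n = 2 * (real n * (c / 2 ^ Suc n))" for n
    by (simp add: power_one_over field_simps)
  ultimately show ?thesis by simp
qed

text \<open>The smaller of two distinct dyadic angles is at most half of the larger, so their gap is
  at least half of the larger; \<open>half_le_sin\<close> costs another factor 2.\<close>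

lemma sin_dyadic_difference_ge:
  assumes "n < m"
  shows "1 / 2 ^ Suc n / 4 \<le> \<bar>sin (1 / 2 ^ Suc m - 1 / 2 ^ Suc n :: real)\<bar>"
proof -
  define s t :: real where "s = 1 / 2 ^ Suc n" and "t = 1 / 2 ^ Suc m"
  have "2 * (2::real) ^ Suc n \<le> 2 ^ Suc m"
    using power_increasing[of "Suc (Suc n)" "Suc m" "2::real"] assms by simp
  then have "t \<le> 1 / (2 * 2 ^ Suc n)"
    unfolding t_def by (intro divide_left_mono) auto
  then have t: "0 < t" "t \<le> s / 2" by (auto simp: t_def s_def)
  have s: "0 < s" "s \<le> 1" using one_le_power[of "2::real" "Suc n"] by (auto simp: s_def field_simps)
  have "s / 4 \<le> (s - t) / 2" using t by simp
  also have "\<dots> \<le> sin (s - t)" using s t by (intro half_le_sin) auto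
  also have "\<dots> \<le> \<bar>sin (t - s)\<bar>" by (metis abs_ge_self abs_minus_cancel minus_diff_eq sin_minus)
  finally show ?thesis by (simp add: s_def t_def)
qed

section \<open>Gram bound and lower bound for the series at tangential zeros\<close>

context
  fixes y w :: "nat \<Rightarrow> real" and X :: real
  assumes y_pos: "\<And>k. 0 < y k" and y_le: "\<And>k. y k \<le> X" and y_small: "\<And>k. y k / 4 ^ Suc k < 1"
    and w_pos: "\<And>k. 0 < w k" and w_le: "\<And>k. w k \<le> 1"
begin

text \<open>The power 2^(-k-1) is the argument of the zero. It offsets the kernel's size 2^(k+1)
  near 1, leaving y_k w_k in the lower bound, while its square offsets 4^(k+1) on the Gram diagonal,
  leaving y_k w_k^2.\<close>

abbreviation (input) "coef k \<equiv> y k * w k / 2 ^ Suc k"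

lemma tangential_bound_pos: "0 < X"
  using y_pos[of 0] y_le[of 0] by simp

lemma tangential_coef_pos: "0 < coef k" and tangential_coef_le: "coef k \<le> X / 2 ^ Suc k"
proof -
  show "0 < coef k" using y_pos w_pos by simp
  have "y k * w k \<le> X * 1" using y_le w_le tangential_bound_pos w_pos by (intro mult_mono) (auto intro: less_imp_le)
  then show "coef k \<le> X / 2 ^ Suc k" by (intro divide_right_mono) auto
qed

lemma norm_tangential_zero_less_1: "cmod (tangential_zero y k) < 1"
  using norm_tangential_zero[of y k, OF y_pos y_small] y_pos[of k] by simp

lemma summable_tangential_coef: "summable (\<lambda>k. cmod (complex_of_real (coef k)))"
proof (rule summable_comparison_test'[where N = 0])
  show "summable (\<lambda>k. X / 2 ^ Suc k)" by (rule summable_half_power_Suc)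
  show "norm (cmod (complex_of_real (coef n))) \<le> X / 2 ^ Suc n" for n
    using tangential_coef_le[of n] tangential_coef_pos[of n] by (simp only: norm_of_real real_norm_def abs_abs abs_of_pos)
qed

text \<open>On the diagonal the denominator is at least 1 - |a_n| = y_n / 4^(n+1), whatever
  \<open>r\<close> is. Off it, angular separation makes the denominator at least a quarter of the
  larger angle; this cancels the corresponding power in one coefficient and leaves the decay of the
  other.\<close>

lemma tangential_gram_sum_le:
  assumes r: "0 \<le> r" "r < 1" and A: "finite A"
  shows "(\<Sum>n\<in>A. \<Sum>m\<in>A. cmod (of_real (coef n)) * cmod (of_real (coef m)) /
      cmod (1 - of_real (r\<^sup>2) * (cnj (tangential_zero y n) * tangential_zero y m)))
    \<le> (\<Sum>n\<in>A. y n * (w n)\<^sup>2 + 2 * (real n * (4 * X\<^sup>2 / 2 ^ Suc n)))"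
proof (rule double_sum_le_weighted_diagonal[OF A])
  define \<rho> where "\<rho> k = 1 - y k / 4 ^ Suc k" for k
  define T where "T n m = cmod (of_real (coef n)) * cmod (of_real (coef m)) /
      cmod (1 - of_real (r\<^sup>2) * (cnj (tangential_zero y n) * tangential_zero y m))" for n m
  have rho: "0 < \<rho> k" "\<rho> k < 1" for k using y_small[of k] y_pos[of k] by (auto simp: \<rho>_def)
  have prod_eq: "of_real (r\<^sup>2) * (cnj (tangential_zero y n) * tangential_zero y m) =
      of_real (r\<^sup>2 * \<rho> n * \<rho> m) * cis (1 / 2 ^ Suc m - 1 / 2 ^ Suc n)" for n m
  proof -
    have "cnj (tangential_zero y n) * tangential_zero y m =
        of_real (\<rho> n) * of_real (\<rho> m) * (cis (- (1 / 2 ^ Suc n)) * cis (1 / 2 ^ Suc m))"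
      unfolding tangential_zero_def \<rho>_def complex_cnj_mult complex_cnj_complex_of_real cis_cnj
      by (simp only: mult_ac)
    then show ?thesis unfolding cis_mult by (simp add: mult.assoc)
  qed
  have T_eq: "T n m = coef n * coef m /
      cmod (1 - of_real (r\<^sup>2 * \<rho> n * \<rho> m) * cis (1 / 2 ^ Suc m - 1 / 2 ^ Suc n))" for n m
    unfolding T_def prod_eq norm_of_real using tangential_coef_pos[of n] tangential_coef_pos[of m] by (simp only: abs_of_pos)
  show "0 \<le> 4 * X\<^sup>2 / 2 ^ Suc n" for n by simp
  show "cmod (of_real (coef n)) * cmod (of_real (coef n)) /
      cmod (1 - of_real (r\<^sup>2) * (cnj (tangential_zero y n) * tangential_zero y n)) \<le> y n * (w n)\<^sup>2" for n
  proof -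
    have "r\<^sup>2 * \<rho> n * \<rho> n \<le> 1 * 1 * \<rho> n"
      using r rho[of n] by (intro mult_mono power_le_one) auto
    then have "y n / 4 ^ Suc n \<le> 1 - r\<^sup>2 * \<rho> n * \<rho> n" by (simp add: \<rho>_def)
    also have "\<dots> \<le> cmod (of_real (1 - r\<^sup>2 * \<rho> n * \<rho> n))" by (simp only: norm_of_real abs_ge_self)
    finally have le: "y n / 4 ^ Suc n \<le> cmod (of_real (1 - r\<^sup>2 * \<rho> n * \<rho> n))" .
    have pos: "0 < y n / 4 ^ Suc n" using y_pos[of n] by simp
    have "coef n * coef n / cmod (of_real (1 - r\<^sup>2 * \<rho> n * \<rho> n)) \<le> coef n * coef n / (y n / 4 ^ Suc n)"
      using tangential_coef_pos[of n] by (intro divide_left_mono[OF le _ mult_pos_pos[OF less_le_trans[OF pos le] pos]]) simp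
    also have "\<dots> = y n * (w n)\<^sup>2"
    proof -
      have "(4::real) ^ Suc n = 2 ^ Suc n * 2 ^ Suc n"
        by (simp only: power_mult_distrib[symmetric]) simp
      then show ?thesis using y_pos[of n] by (simp add: power2_eq_square)
    qed
    finally have "T n n \<le> y n * (w n)\<^sup>2" unfolding T_eq by simp
    then show ?thesis by (simp only: T_def)
  qed
  \<comment> \<open>Here \<open>i\<close> is the smaller index; keeping \<open>D\<close> abstract
    serves both triangles.\<close>
  have off_diag: "coef i * coef j / D \<le> 4 * X\<^sup>2 / 2 ^ Suc j"
    if "1 / 2 ^ Suc i / 4 \<le> D" for i j D
  proof -
    have "coef i * coef j / D \<le> (X / 2 ^ Suc i) * (X / 2 ^ Suc j) / (1 / 2 ^ Suc i / 4)"
      using tangential_bound_pos y_pos w_pos by (intro frac_le mult_mono tangential_coef_le that) (auto intro: less_imp_le)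
    also have "\<dots> = 4 * X\<^sup>2 / 2 ^ Suc j" by (simp add: power2_eq_square)
    finally show ?thesis .
  qed
  have sep: "1 / 2 ^ Suc i / 4 \<le> cmod (1 - of_real (r\<^sup>2 * \<rho> n * \<rho> m) * cis (1 / 2 ^ Suc m - 1 / 2 ^ Suc n))"
    if "1 / 2 ^ Suc i / 4 \<le> \<bar>sin (1 / 2 ^ Suc m - 1 / 2 ^ Suc n :: real)\<bar>" for i n m
    using that abs_sin_le_norm_one_minus_cis by (rule order_trans)
  show "cmod (of_real (coef n)) * cmod (of_real (coef m)) /
      cmod (1 - of_real (r\<^sup>2) * (cnj (tangential_zero y n) * tangential_zero y m)) \<le> 4 * X\<^sup>2 / 2 ^ Suc m"
    if "n < m" for n m
  proof -
    have "T n m \<le> 4 * X\<^sup>2 / 2 ^ Suc m"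
      unfolding T_eq by (rule off_diag[OF sep[OF sin_dyadic_difference_ge[OF that]]])
    then show ?thesis by (simp only: T_def)
  qed
  show "cmod (of_real (coef n)) * cmod (of_real (coef m)) /
      cmod (1 - of_real (r\<^sup>2) * (cnj (tangential_zero y n) * tangential_zero y m)) \<le> 4 * X\<^sup>2 / 2 ^ Suc n"
    if "m < n" for n m
  proof -
    have "\<bar>sin (1 / 2 ^ Suc n - 1 / 2 ^ Suc m :: real)\<bar> = \<bar>sin (1 / 2 ^ Suc m - 1 / 2 ^ Suc n)\<bar>"
      by (metis abs_minus_cancel minus_diff_eq sin_minus)
    with sin_dyadic_difference_ge[OF that]
    have "1 / 2 ^ Suc m / 4 \<le> \<bar>sin (1 / 2 ^ Suc m - 1 / 2 ^ Suc n :: real)\<bar>" by simp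
    from off_diag[OF sep[OF this], of n] have "T n m \<le> 4 * X\<^sup>2 / 2 ^ Suc n"
      unfolding T_eq by (simp only: mult.commute)
    then show ?thesis by (simp only: T_def)
  qed
qed

text \<open>
  Near \<open>1\<close> the first \<open>M\<close> kernels essentially point in the direction \<open>- \<i>\<close>, so their contributions
  cannot cancel.
\<close>

lemma norm_tangential_series_ge:
  assumes rho_min: "\<And>k. \<rho> \<le> 1 - y k / 4 ^ Suc k" and rho: "0 < \<rho>"
    and z: "cmod z < 1" "cmod (1 - z) \<le> 1 / 2 ^ M / 16"
  shows "\<rho> / (8 * (2 + X)\<^sup>2) * (\<Sum>k<M. y k * w k) - X / 2 ^ M / (1 - cmod z)
    \<le> cmod (\<Sum>k. of_real (coef k) * szego_kernel (tangential_zero y k) z)"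
proof -
  define F where "F k = of_real (coef k) * szego_kernel (tangential_zero y k) z" for k
  have summ: "summable F"
    unfolding F_def[abs_def] by (rule summable_szego_series[OF norm_tangential_zero_less_1 summable_tangential_coef z(1)])
  have "\<rho> / (8 * (2 + X)\<^sup>2) * (\<Sum>k<M. y k * w k) \<le> (\<Sum>k<M. - Im (F k))"
    unfolding sum_distrib_left
  proof (intro sum_mono)
    fix k assume "k \<in> {..<M}"
    define t :: real where "t = 1 / 2 ^ Suc k"
    have t: "0 < t" "t \<le> 1 / 2" using one_le_power[of "2::real" k] by (auto simp: t_def field_simps)
    have "(2::real) ^ Suc k \<le> 2 ^ M" using \<open>k \<in> {..<M}\<close> by (intro power_increasing) auto
    then have "1 / 2 ^ M \<le> t" unfolding t_def by (intro divide_left_mono) auto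
    then have zt: "cmod (1 - z) \<le> t / 16" using z(2) by simp
    \<comment> \<open>The radial defect is \<open>y k\<close> times t^2; since t \<le> 1 it is at
      most X t, as \<open>neg_Im_szego_kernel_ge\<close> requires.\<close>
    have tt: "y k / 4 ^ Suc k = y k * t * t"
    proof -
      have "(4::real) ^ Suc k = 2 ^ Suc k * 2 ^ Suc k"
        by (simp only: power_mult_distrib[symmetric]) simp
      then show ?thesis by (simp add: t_def)
    qed
    have "y k * t * t < 1" using y_small[of k] unfolding tt .
    moreover have "y k * t * t \<le> X * t * 1" using t y_le[of k] y_pos[of k] tangential_bound_pos by (intro mult_mono) auto
    ultimately have "(1 - y k / 4 ^ Suc k) / (8 * (2 + X)\<^sup>2 * t) \<le> - Im (szego_kernel (tangential_zero y k) z)"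
      unfolding tangential_zero_def t_def[symmetric] tt
      using y_small[of k] y_pos[of k] t tangential_bound_pos zt z(1)
      by (intro neg_Im_szego_kernel_ge) (auto simp: tt)
    moreover have "\<rho> / (8 * (2 + X)\<^sup>2 * t) \<le> (1 - y k / 4 ^ Suc k) / (8 * (2 + X)\<^sup>2 * t)"
      using rho_min[of k] t by (intro divide_right_mono) auto
    ultimately have "coef k * (\<rho> / (8 * (2 + X)\<^sup>2 * t)) \<le> coef k * (- Im (szego_kernel (tangential_zero y k) z))"
      using tangential_coef_pos[of k] by (intro mult_left_mono) linarith+
    moreover have "coef k * (\<rho> / (8 * (2 + X)\<^sup>2 * t)) = \<rho> / (8 * (2 + X)\<^sup>2) * (y k * w k)"
      unfolding t_def by simp
    moreover have "- Im (F k) = coef k * (- Im (szego_kernel (tangential_zero y k) z))"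
      unfolding F_def by (simp only: Im_complex_of_real times_complex.sel) simp
    ultimately show "\<rho> / (8 * (2 + X)\<^sup>2) * (y k * w k) \<le> - Im (F k)" by simp
  qed
  also have "\<dots> = - Im (\<Sum>k<M. F k)" by (simp add: sum_negf)
  also have "\<dots> \<le> cmod (\<Sum>k<M. F k)" using abs_Im_le_cmod[of "\<Sum>k<M. F k"] by simp
  finally have head: "\<rho> / (8 * (2 + X)\<^sup>2) * (\<Sum>k<M. y k * w k) \<le> cmod (\<Sum>k<M. F k)" .
  \<comment> \<open>From index \<open>M\<close> on, the crude kernel bound 1 / (1 - |z|) suffices,
    because the coefficients sum geometrically to at most X / 2^M.\<close>
  have tail: "cmod (\<Sum>k. F (k + M)) \<le> X / 2 ^ M / (1 - cmod z)"
  proof -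
    have sums: "(\<lambda>k. X / 2 ^ Suc (k + M) / (1 - cmod z)) sums (X / 2 ^ M / (1 - cmod z))"
    proof -
      have "(\<lambda>k. X / 2 ^ M / (1 - cmod z) * (1/2) ^ Suc k) sums (X / 2 ^ M / (1 - cmod z) * 1)"
        by (rule sums_mult[OF power_half_series])
      then show ?thesis by (simp add: power_one_over power_add mult_ac)
    qed
    have "cmod (F k) \<le> X / 2 ^ Suc k / (1 - cmod z)" for k
    proof -
      have "cmod (F k) \<le> cmod (of_real (coef k)) / (1 - cmod z)"
        unfolding F_def by (rule szego_series_dominated[OF norm_tangential_zero_less_1 z(1)])
      also have "cmod (of_real (coef k)) = coef k" unfolding norm_of_real using tangential_coef_pos by (rule abs_of_pos)
      also have "coef k / (1 - cmod z) \<le> X / 2 ^ Suc k / (1 - cmod z)"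
        using z(1) by (intro divide_right_mono tangential_coef_le) auto
      finally show ?thesis .
    qed
    then have "cmod (\<Sum>k. F (k + M)) \<le> (\<Sum>k. X / 2 ^ Suc (k + M) / (1 - cmod z))"
      by (intro norm_suminf_le sums_summable[OF sums])
    then show ?thesis using sums_unique[OF sums] by simp
  qed
  have "(\<Sum>k. F k) = (\<Sum>k. F (k + M)) + (\<Sum>k<M. F k)"
    by (rule suminf_split_initial_segment[OF summ])
  then have "cmod (\<Sum>k<M. F k) - cmod (\<Sum>k. F (k + M)) \<le> cmod (\<Sum>k. F k)"
    using norm_diff_ineq[of "\<Sum>k<M. F k" "\<Sum>k. F (k + M)"] by (simp add: add.commute)
  with head tail show ?thesis unfolding F_def by linarith
qed

end

section \<open>Choice of weights, membership in the complement, growth in Stolz domains\<close>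

theorem theorem3p10:
  fixes x :: "nat \<Rightarrow> real" and lam :: "nat \<Rightarrow> complex" and B :: "complex \<Rightarrow> complex"
    and \<sigma> :: "nat \<Rightarrow> real" and \<phi>\<^sub>0 \<phi> :: "real \<Rightarrow> real"
  assumes x_pos: "\<And>n. n \<ge> 1 \<Longrightarrow> x n > 0"
    and x_noninc: "\<And>m n. 1 \<le> m \<Longrightarrow> m \<le> n \<Longrightarrow> x n \<le> x m"
    and x_lim: "x \<longlonglongrightarrow> 0"
    and x_small: "\<And>n. n \<ge> 1 \<Longrightarrow> x n / 2 ^ (2 * n) < 1"
    and x_div: "filterlim (\<lambda>N. \<Sum>n=1..N. x n) at_top sequentially"
    and zeros: "\<And>n. n \<ge> 1 \<Longrightarrow> lam n = of_real (1 - x n / 2 ^ (2 * n)) * cis (1 / 2 ^ n)"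
    and B_def: "B = blaschke_product (\<lambda>k. lam (Suc k))"
    and sigma_def: "\<And>N. \<sigma> N = (\<Sum>n=1..N. x n)"
    and phi0_pos: "\<And>y. y \<ge> 1 \<Longrightarrow> \<phi>\<^sub>0 y > 0"
    and phi0_cont: "continuous_on {1..} \<phi>\<^sub>0"
    and phi0_affine: "\<And>N::nat. N \<ge> 1 \<Longrightarrow> \<exists>a b. \<forall>y\<in>{real N..real N + 1}. \<phi>\<^sub>0 y = a * y + b"
    and phi0_nodes: "\<And>N::nat. N \<ge> 1 \<Longrightarrow> \<phi>\<^sub>0 (real N) = \<sigma> N"
    and phi_def: "\<And>y. y \<in> {1/2..<1} \<Longrightarrow> \<phi> y = \<phi>\<^sub>0 (log 2 (1 / (1 - y)))"
  shows "\<forall>\<epsilon>>0. \<exists>f \<in> hardy_orth_compl (mult_H2 B). \<forall>\<alpha>>1.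
           \<exists>c>0. \<exists>r\<^sub>0\<in>{1/2..<1}. \<forall>z\<in>stolz_domain \<alpha> 1. r\<^sub>0 \<le> cmod z \<longrightarrow>
             \<phi> (cmod z) > 1 \<and>
             cmod (f z) \<ge> c * sqrt (\<phi> (cmod z) / ln (\<phi> (cmod z)) powr (1 + \<epsilon>))"
proof (intro allI impI)
  fix \<epsilon> :: real assume eps: "\<epsilon> > 0"
  define y where "y k = x (Suc k)" for k
  define X where "X = x 1"
  \<comment> \<open>The offset \<open>exp 1\<close> forces ln (S k) \<ge> 1 from the start, so the
    weights are defined and at most 1 even while the partial sums are small.\<close>
  define S where "S k = exp 1 + \<sigma> k" for k
  define W where "W t = 1 / sqrt (t * ln t powr (1 + \<epsilon>))" for t :: real
  define w where "w k = W (S (Suc k))" for k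
  define f where "f z = (\<Sum>k. of_real (y k * w k / 2 ^ Suc k) * szego_kernel (tangential_zero y k) z)" for z
  have four: "(2::real) ^ (2 * n) = 4 ^ n" for n by (simp add: power_mult)
  have y_pos: "0 < y k" and y_le: "y k \<le> X" and y_small: "y k / 4 ^ Suc k < 1" for k
    using x_pos[of "Suc k"] x_noninc[of 1 "Suc k"] x_small[of "Suc k"] by (auto simp: y_def X_def four[of "Suc k"] simp del: mult_Suc_right)
  have sigma_eq: "\<sigma> N = (\<Sum>k<N. y k)" for N
    unfolding sigma_def y_def by (rule sum.atLeast1_atMost_eq[unfolded One_nat_def[symmetric]])
  have sigma_mono: "mono \<sigma>"
    unfolding sigma_eq[abs_def] using y_pos by (intro monoI sum_mono2) (auto intro: less_imp_le)
  have S_mono: "mono S" using sigma_mono by (auto simp: S_def mono_def)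
  have S_ge: "exp 1 \<le> S k" for k
    using monoD[OF sigma_mono, of 0 k] by (simp add: S_def sigma_eq)
  have denom_ge_1: "1 \<le> t * ln t powr (1 + \<epsilon>)" and ln_ge_1: "1 \<le> ln t" and ge_1: "1 \<le> t" if "exp 1 \<le> t" for t :: real
  proof -
    show t: "1 \<le> t" using that exp_ge_add_one_self[of 1] by linarith
    then show ln: "1 \<le> ln t" using that by (simp add: ln_ge_iff)
    then have "1 \<le> ln t powr (1 + \<epsilon>)" using eps by (intro ge_one_powr_ge_zero) auto
    with t show "1 \<le> t * ln t powr (1 + \<epsilon>)" using mult_mono[of 1 t 1 "ln t powr (1 + \<epsilon>)"] by simp
  qed
  have W_antimono: "W t' \<le> W t" if "exp 1 \<le> t" "t \<le> t'" for t t'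
  proof -
    have "t * ln t powr (1 + \<epsilon>) \<le> t' * ln t' powr (1 + \<epsilon>)"
      using that eps ln_ge_1[OF that(1)] ge_1[OF that(1)] by (intro mult_mono powr_mono2) auto
    then show ?thesis using denom_ge_1[OF that(1)] unfolding W_def by (intro divide_left_mono) (auto intro!: mult_pos_pos)
  qed
  have w_pos: "0 < w k" and w_le: "w k \<le> 1" for k
    using denom_ge_1[OF S_ge[of "Suc k"]] by (auto simp: w_def W_def)

  have lam_eq: "lam (Suc k) = tangential_zero y k" for k
    using zeros[of "Suc k"] unfolding tangential_zero_def y_def four[of "Suc k"] by simp
  have tz: "cmod (tangential_zero y k) < 1" for k
    by (rule norm_tangential_zero_less_1[OF y_pos y_le y_small w_pos w_le])
  have "summable (\<lambda>k. 1 - cmod (tangential_zero y k))"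
  proof (rule summable_comparison_test'[where N = 0])
    show "summable (\<lambda>k. X / 2 ^ Suc k)" by (rule summable_half_power_Suc)
    show "norm (1 - cmod (tangential_zero y k)) \<le> X / 2 ^ Suc k" for k
    proof -
      have "y k / 4 ^ Suc k \<le> X / 2 ^ Suc k"
        using y_le[of k] y_pos[of k] by (intro frac_le power_mono) auto
      then show ?thesis using norm_tangential_zero[of y k, OF y_pos y_small] y_pos[of k] by simp
    qed
  qed
  note B = holomorphic_blaschke_product[OF tz this] norm_blaschke_product_le_1[OF tz this] blaschke_product_zero[OF tz this]
  have B_eq: "B = blaschke_product (tangential_zero y)" by (simp add: B_def lam_eq)

  have "f \<in> hardy_orth_compl (mult_H2 B)"
    unfolding f_def[abs_def]
  proof (rule szego_series_in_orth_compl)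
    show "cmod (tangential_zero y n) < 1" for n by (rule tz)
    show "summable (\<lambda>n. cmod (complex_of_real (y n * w n / 2 ^ Suc n)))"
      by (rule summable_tangential_coef[OF y_pos y_le y_small w_pos w_le])
    show "summable (\<lambda>n. y n * (w n)\<^sup>2 + 2 * (real n * (4 * X\<^sup>2 / 2 ^ Suc n)))"
    proof (intro summable_add summable_weighted_half_power_Suc)
      \<comment> \<open>As \<open>y k\<close> is the increment of \<open>S\<close> and
        \<open>w k\<close> uses the right endpoint \<open>S (Suc k)\<close>, the diagonal is exactly
        the series of \<open>summable_increments_log_power\<close>.\<close>
      have "y k * (w k)\<^sup>2 = (S (Suc k) - S k) / (S (Suc k) * ln (S (Suc k)) powr (1 + \<epsilon>))" for k
      proof -
        have "S (Suc k) - S k = y k" by (simp add: S_def sigma_eq)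
        moreover have "(w k)\<^sup>2 = 1 / (S (Suc k) * ln (S (Suc k)) powr (1 + \<epsilon>))"
          unfolding w_def W_def power_divide using denom_ge_1[OF S_ge[of "Suc k"]] by (subst real_sqrt_pow2) auto
        ultimately show ?thesis by simp
      qed
      then show "summable (\<lambda>k. y k * (w k)\<^sup>2)"
        using summable_increments_log_power[OF S_mono S_ge eps] by simp
    qed
    show "(\<Sum>n\<in>A. \<Sum>m\<in>A. cmod (of_real (y n * w n / 2 ^ Suc n)) * cmod (of_real (y m * w m / 2 ^ Suc m)) /
        cmod (1 - of_real (r\<^sup>2) * (cnj (tangential_zero y n) * tangential_zero y m)))
      \<le> (\<Sum>n\<in>A. y n * (w n)\<^sup>2 + 2 * (real n * (4 * X\<^sup>2 / 2 ^ Suc n)))"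
      if "0 \<le> r" "r < 1" "finite A" for r A
      by (rule tangential_gram_sum_le[OF y_pos y_le y_small w_pos w_le that])
    show "mult_H2 B \<subseteq> hardy_H2"
      unfolding B_eq by (intro mult_H2_subset_hardy_H2 B)
    show "h (tangential_zero y n) = 0" if "h \<in> mult_H2 B" for h n
      using that B(3) by (auto simp: mult_H2_def B_eq)
  qed
  moreover have "\<exists>c>0. \<exists>r\<^sub>0\<in>{1/2..<1}. \<forall>z\<in>stolz_domain \<alpha> 1. r\<^sub>0 \<le> cmod z \<longrightarrow>
      \<phi> (cmod z) > 1 \<and> cmod (f z) \<ge> c * sqrt (\<phi> (cmod z) / ln (\<phi> (cmod z)) powr (1 + \<epsilon>))"
    if alpha: "\<alpha> > 1" for \<alpha>
  proof -
    \<comment> \<open>Later 1 - |z| \<le> 2 / 2^N, so a Stolz point satisfies |1 - z| \<le> 2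
      \<alpha> / 2^N. The constant 32 makes this at most 2^(-(N-C)) / 16, the closeness needed to
      use the first N - C kernels.\<close>
    obtain C where C: "32 * \<alpha> \<le> 2 ^ C"
      using real_arch_pow[of 2 "32 * \<alpha>"] by (auto intro: less_imp_le)
    have "C \<noteq> 0" using C alpha by (intro notI) auto
    \<comment> \<open>The smallest modulus among the zeros, attained at the first one because x_n /
      4^n decreases.\<close>
    define \<rho> where "\<rho> = 1 - y 0 / 4"
    define c where "c = \<rho> / (8 * (2 + X)\<^sup>2)"
    have X_pos: "0 < X" using y_pos[of 0] y_le[of 0] by simp
    have rho: "0 < \<rho>" using y_small[of 0] by (simp add: \<rho>_def)
    have rho_le: "\<rho> \<le> 1 - y k / 4 ^ Suc k" for k
    proof -
      have "(4::real) ^ 1 \<le> 4 ^ Suc k" by (rule power_increasing) auto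
      then have "y k / 4 ^ Suc k \<le> y 0 / 4"
        using x_noninc[of 1 "Suc k"] y_pos[of k] y_pos[of 0] by (intro frac_le) (auto simp: y_def)
      then show ?thesis by (simp add: \<rho>_def)
    qed
    have c: "c > 0" using rho X_pos by (auto simp: c_def intro!: divide_pos_pos mult_pos_pos zero_less_power)
    \<comment> \<open>The shift C X bounds the growth of \<sigma> over \<open>C\<close> indices, and
      X 2^C is the bound on the tail of the series.\<close>
    have "\<forall>\<^sub>F s in at_top. c / 4 * sqrt ((s + real C * X) / ln s powr (1 + \<epsilon>)) \<le>
        c * (s / sqrt ((exp 1 + s) * ln (exp 1 + s) powr (1 + \<epsilon>))) - X * 2 ^ C"
      using c eps by (intro eventually_sqrt_log_power_comparison) auto
    then obtain T where T: "\<And>s. T \<le> s \<Longrightarrow> c / 4 * sqrt ((s + real C * X) / ln s powr (1 + \<epsilon>)) \<le>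
        c * (s / sqrt ((exp 1 + s) * ln (exp 1 + s) powr (1 + \<epsilon>))) - X * 2 ^ C"
      unfolding eventually_at_top_linorder by blast
    have "filterlim \<sigma> at_top sequentially" using x_div by (simp add: sigma_def[abs_def])
    then have "\<forall>\<^sub>F N in sequentially. max T (exp 1) \<le> \<sigma> N" by (simp only: filterlim_at_top)
    then obtain M0 where M0: "\<And>M. M \<ge> M0 \<Longrightarrow> max T (exp 1) \<le> \<sigma> M"
      unfolding eventually_sequentially by blast
    \<comment> \<open>Guarantees both N - C \<ge> \<open>M0\<close> and N \<ge> 2; the latter lets
      the affine piece on [N - 1, N] start at 1 or later.\<close>
    define N0 where "N0 = M0 + C + 2"
    define r0 :: real where "r0 = 1 - 1 / 2 ^ N0"
    have r0: "r0 \<in> {1/2..<1}"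
    proof -
      have "(2::real) ^ 1 \<le> 2 ^ N0" by (rule power_increasing) (auto simp: N0_def)
      then have "1 / (2::real) ^ N0 \<le> 1 / 2" by (intro divide_left_mono) auto
      then show ?thesis by (simp add: r0_def)
    qed
    have "\<phi> (cmod z) > 1 \<and> cmod (f z) \<ge> c / 4 * sqrt (\<phi> (cmod z) / ln (\<phi> (cmod z)) powr (1 + \<epsilon>))"
      if z: "z \<in> stolz_domain \<alpha> 1" and zr: "r0 \<le> cmod z" for z
    proof -
      define \<delta> where "\<delta> = 1 - cmod z"
      define u where "u = log 2 (1 / \<delta>)"
      \<comment> \<open>Rounding up places 1 - |z| between 2^(-N) and 2 / 2^N and \<open>u\<close>
        in the interval [N - 1, N].\<close>
      define N where "N = nat \<lceil>u\<rceil>"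
      define M where "M = N - C"
      define v where "v = \<phi> (cmod z)"
      from z have z1: "cmod z < 1" and "cmod (z - 1) / \<delta> < \<alpha>"
        by (auto simp: stolz_domain_def \<delta>_def)
      then have delta: "0 < \<delta>" "\<delta> \<le> 1 / 2 ^ N0" and z_near: "cmod (1 - z) \<le> \<alpha> * \<delta>"
        using zr by (auto simp: \<delta>_def r0_def field_simps norm_minus_commute)
      have "2 ^ N0 \<le> 1 / \<delta>" using delta by (simp add: field_simps)
      then have "log 2 (2 ^ N0) \<le> u" unfolding u_def by (subst log_le_cancel_iff) (use delta in auto)
      then have uN0: "real N0 \<le> u" by (simp add: log_nat_power)
      then have N: "u \<le> real N" "real N < u + 1" unfolding N_def by linarith+
      with uN0 have NN0: "N0 \<le> N" by linarith
      have u_powr: "2 powr u = 1 / \<delta>" unfolding u_def using delta by (simp add: powr_log_cancel)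
      have "1 / \<delta> \<le> 2 powr real N" using N(1) unfolding u_powr[symmetric] by simp
      then have inv_delta: "1 / \<delta> \<le> 2 ^ N" by (simp add: powr_realpow)
      have "2 powr (real N - 1) \<le> 1 / \<delta>" using N(2) unfolding u_powr[symmetric] by simp
      then have "2 ^ N / 2 \<le> 1 / \<delta>" by (simp add: powr_diff powr_realpow)
      then have delta_le: "\<delta> \<le> 2 / 2 ^ N" using delta by (simp add: field_simps)
      have MN: "N = M + C" "M0 \<le> M" "M \<le> N - 1" "2 \<le> N" using NN0 \<open>C \<noteq> 0\<close> by (auto simp: M_def N0_def)
      have pow_N: "(2::real) ^ N = 2 ^ M * 2 ^ C" unfolding MN(1) by (rule power_add)
      have near: "cmod (1 - z) \<le> 1 / 2 ^ M / 16"
      proof -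
        have "\<alpha> * \<delta> \<le> (2 ^ C / 32) * (2 / 2 ^ N)" using C alpha delta delta_le by (intro mult_mono) auto
        also have "\<dots> = 1 / 2 ^ M / 16" unfolding pow_N by simp
        finally show ?thesis using z_near by simp
      qed
      have tail: "X / 2 ^ M / \<delta> \<le> X * 2 ^ C"
      proof -
        have "X / 2 ^ M * (1 / \<delta>) \<le> X / 2 ^ M * 2 ^ N" using inv_delta X_pos by (intro mult_left_mono) auto
        also have "\<dots> = X * 2 ^ C" unfolding pow_N by simp
        finally show ?thesis by simp
      qed
      have sigma_M: "T \<le> \<sigma> M" "exp 1 \<le> \<sigma> M" using M0[OF MN(2)] by auto
      \<comment> \<open>\<open>W\<close> decreases and \<open>w k\<close> is taken at index k + 1
        \<le> M, so the last weight bounds all of them from below.\<close>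
      have "\<sigma> M * W (S M) \<le> (\<Sum>k<M. y k * w k)"
        unfolding sigma_eq[of M] sum_distrib_right
      proof (intro sum_mono mult_left_mono)
        show "W (S M) \<le> w k" if "k \<in> {..<M}" for k
          unfolding w_def using that by (intro W_antimono S_ge monoD[OF S_mono]) auto
      qed (use y_pos in \<open>auto intro: less_imp_le\<close>)
      then have "c * (\<sigma> M * W (S M)) - X * 2 ^ C \<le> c * (\<Sum>k<M. y k * w k) - X / 2 ^ M / (1 - cmod z)"
        using c tail unfolding \<delta>_def by (intro diff_mono mult_left_mono) auto
      also have "\<dots> \<le> cmod (f z)"
        unfolding f_def c_def
        by (rule norm_tangential_series_ge[OF y_pos y_le y_small w_pos w_le rho_le rho z1 near])
      finally have f_ge: "c * (\<sigma> M * W (S M)) - X * 2 ^ C \<le> cmod (f z)" .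
      \<comment> \<open>On [N - 1, N] the affine piece is nondecreasing, which puts \<open>v\<close>
        between \<sigma>(N-1) and \<sigma>(N). Since C is nonzero, M \<le> N - 1 gives the lower
        bound; the upper one adds \<open>C\<close> terms of size at most \<open>X\<close>.\<close>
      have v_bounds: "\<sigma> M \<le> v" "v \<le> \<sigma> M + real C * X"
      proof -
        obtain N' where N': "N = Suc N'" "1 \<le> N'" using MN(4) by (cases N) auto
        obtain a b where ab: "\<And>t. t \<in> {real N'..real N' + 1} \<Longrightarrow> \<phi>\<^sub>0 t = a * t + b"
          using phi0_affine[OF N'(2)] by blast
        have u_mem: "u \<in> {real N'..real N' + 1}" using N N'(1) by auto
        have v_eq: "v = a * u + b"
          using phi_def[of "cmod z"] zr r0 z1 ab[OF u_mem] by (simp add: v_def u_def \<delta>_def)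
        have lo: "\<sigma> N' = a * real N' + b"
          using ab[of "real N'"] phi0_nodes[OF N'(2)] by simp
        have hi: "\<sigma> N = a * (real N' + 1) + b"
          using ab[of "real N' + 1"] phi0_nodes[of N] N'(1) by (simp add: add.commute)
        have "0 \<le> a" using monoD[OF sigma_mono, of N' N] N'(1) lo hi by (simp add: algebra_simps)
        then have "a * real N' \<le> a * u" "a * u \<le> a * (real N' + 1)" using u_mem by (auto intro!: mult_left_mono)
        then have v: "\<sigma> N' \<le> v" "v \<le> \<sigma> N" using v_eq lo hi by auto
        have "\<sigma> M \<le> \<sigma> N'" using MN(3) N'(1) by (intro monoD[OF sigma_mono]) auto
        with v show "\<sigma> M \<le> v" by simp
        have "\<sigma> N = \<sigma> M + sum y {M..<N}"
          unfolding sigma_eq using MN(1) by (simp add: sum.atLeastLessThan_concat lessThan_atLeast0)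
        also have "sum y {M..<N} \<le> of_nat (card {M..<N}) * X" using y_le by (intro sum_bounded_above)
        also have "card {M..<N} = C" using MN(1) by simp
        finally show "v \<le> \<sigma> M + real C * X" using v by simp
      qed
      have ln_M: "1 \<le> ln (\<sigma> M)" by (rule ln_ge_1[OF sigma_M(2)])
      have "v > 1" using v_bounds(1) sigma_M(2) exp_ge_add_one_self[of 1] by linarith
      \<comment> \<open>The function s / (ln s)^(1+\<epsilon>) need not be monotone here, so
        numerator and denominator are estimated separately by the two bounds on
        \<open>v\<close>.\<close>
      have "sqrt (v / ln v powr (1 + \<epsilon>)) \<le> sqrt ((\<sigma> M + real C * X) / ln (\<sigma> M) powr (1 + \<epsilon>))"
      proof (intro real_sqrt_le_mono frac_le powr_mono2)
        show "ln (\<sigma> M) \<le> ln v" using v_bounds(1) ge_1[OF sigma_M(2)] by simp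
      qed (use v_bounds \<open>v > 1\<close> ln_M eps in auto)
      then have "c / 4 * sqrt (v / ln v powr (1 + \<epsilon>)) \<le>
          c / 4 * sqrt ((\<sigma> M + real C * X) / ln (\<sigma> M) powr (1 + \<epsilon>))"
        using c by (intro mult_left_mono) auto
      also have "\<dots> \<le> c * (\<sigma> M * W (S M)) - X * 2 ^ C"
        using T[OF sigma_M(1)] by (simp add: W_def S_def)
      also note f_ge
      finally show ?thesis using \<open>v > 1\<close> by (simp add: v_def)
    qed
    moreover have "c / 4 > 0" using c by simp
    ultimately show ?thesis using r0 by blast
  qed
  ultimately show "\<exists>f \<in> hardy_orth_compl (mult_H2 B). \<forall>\<alpha>>1.
           \<exists>c>0. \<exists>r\<^sub>0\<in>{1/2..<1}. \<forall>z\<in>stolz_domain \<alpha> 1. r\<^sub>0 \<le> cmod z \<longrightarrow>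
             \<phi> (cmod z) > 1 \<and>
             cmod (f z) \<ge> c * sqrt (\<phi> (cmod z) / ln (\<phi> (cmod z)) powr (1 + \<epsilon>))"
    by blast
qed

end
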